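(* Let $f,g\colon X\to Y$ be maps and let $R$ be a commutative ring. Suppose there exist cohomology classes $u_0,u_1,\dots,u_k\in H^*(Y\times Y;R)$ with $$\Delta_Y^*(u_0)=\Delta_Y^*(u_1)=\cdots=\Delta_Y^*(u_k)=0\quad\text{and}\quad (f,g)^*(u_0\smile u_1\smile\cdots\smile u_k)\neq 0,$$ where $\Delta_Y\colon Y\to Y\times Y$ denotes the diagonal map. Then $\mathrm{D}_m(f,g)\ge k+1$, where $m=\max\{\deg(u_i)\mid i=0,1,\dots,k\}$.
   Context: Cohomology classes are homogeneous, and $\deg(u)$ is the degree of $u$. The map $(f,g)\colon X\to Y\times Y$ is $x\mapsto(f(x),g(x))$. For an integer $m\ge0$, the $m$-homotopic distance $\mathrm{D}_m(f,g)$ between maps $f,g\colon X\to Y$ is the least integer $k$ such that $X$ admits an open cover $\{U_i\}_{i=0}^k$ such that, for each $i$ and every map $\phi\colon P\to U_i$ from an $m$-dimensional CW complex $P$, one has $f|_{U_i}\circ\phi\simeq g|_{U_i}\circ\phi$ ($\infty$ if there is no such cover). *)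

theory Defs
  imports "HOL-Homology.Homology" "HOL-Library.Extended_Nat"
begin

section \<open>Singular cohomology with coefficients in a commutative ring\<close>

text \<open>
  A singular \<open>n\<close>-cochain of \<open>X\<close> is given by its values on the singular \<open>n\<close>-simplices of \<open>X\<close>;
  it is normalised to be \<open>0\<close> at all functions that are not singular \<open>n\<close>-simplices of \<open>X\<close>, so that
  equality of cochains is equality of functions.
\<close>

type_synonym ('a, 'r) cochain = "((nat \<Rightarrow> real) \<Rightarrow> 'a) \<Rightarrow> 'r"

definition cochains :: "nat \<Rightarrow> 'a topology \<Rightarrow> ('a, 'r::comm_ring_1) cochain set" where
  "cochains n X = {c. \<forall>\<sigma>. \<not> singular_simplex n X \<sigma> \<longrightarrow> c \<sigma> = 0}"

definition cochain_eval :: "('a, 'r::comm_ring_1) cochain \<Rightarrow> 'a chain \<Rightarrow> 'r" where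
  "cochain_eval c z = (\<Sum>\<sigma>\<in>Poly_Mapping.keys z. of_int (Poly_Mapping.lookup z \<sigma>) * c \<sigma>)"

definition cochain_coboundary ::
  "nat \<Rightarrow> 'a topology \<Rightarrow> ('a, 'r::comm_ring_1) cochain \<Rightarrow> ('a, 'r) cochain" where
  "cochain_coboundary n X c =
    (\<lambda>\<sigma>. if singular_simplex (Suc n) X \<sigma>
         then cochain_eval c (chain_boundary (Suc n) (frag_of \<sigma>)) else 0)"

definition cocycles :: "nat \<Rightarrow> 'a topology \<Rightarrow> ('a, 'r::comm_ring_1) cochain set" where
  "cocycles n X = {c \<in> cochains n X. cochain_coboundary n X c = (\<lambda>\<sigma>. 0)}"

definition coboundaries :: "nat \<Rightarrow> 'a topology \<Rightarrow> ('a, 'r::comm_ring_1) cochain set" where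
  "coboundaries n X =
    (case n of 0 \<Rightarrow> {\<lambda>\<sigma>. 0} | Suc p \<Rightarrow> cochain_coboundary p X ` cochains p X)"

definition cocycle_group :: "nat \<Rightarrow> 'a topology \<Rightarrow> ('a, 'r::comm_ring_1) cochain monoid" where
  "cocycle_group n X =
    \<lparr>carrier = cocycles n X, monoid.mult = (\<lambda>a b \<sigma>. a \<sigma> + b \<sigma>), one = (\<lambda>\<sigma>. 0)\<rparr>"

text \<open>
  As for homology groups in the library, the additive group \<open>H\<^sup>n(X;R)\<close> is a quotient of
  (multiplicatively written) groups. Its elements are cosets of cocycles, and its zero
  element is \<open>\<one>\<close>. The coefficient ring \<open>R\<close> is the type \<open>'r\<close>.
\<close>

definition cohomology_group ::
  "nat \<Rightarrow> 'a topology \<Rightarrow> ('a, 'r::comm_ring_1) cochain set monoid" where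
  "cohomology_group n X = cocycle_group n X Mod coboundaries n X"

definition cochain_pullback ::
  "nat \<Rightarrow> 'a topology \<Rightarrow> ('a \<Rightarrow> 'b) \<Rightarrow> ('b, 'r::comm_ring_1) cochain \<Rightarrow> ('a, 'r) cochain" where
  "cochain_pullback n X f c =
    (\<lambda>\<sigma>. if singular_simplex n X \<sigma> then c (simplex_map n f \<sigma>) else 0)"

text \<open>
  Operations on cohomology classes are taken as the union of the cosets obtained from all
  representatives; these cosets coincide, so the union is the class of any one of them.
\<close>

definition cohomology_induced ::
  "nat \<Rightarrow> 'a topology \<Rightarrow> ('a \<Rightarrow> 'b) \<Rightarrow> ('b, 'r::comm_ring_1) cochain set \<Rightarrow> ('a, 'r) cochain set"
  where
  "cohomology_induced n X f u =
    (\<Union>c\<in>u. coboundaries n X #>\<^bsub>cocycle_group n X\<^esub> cochain_pullback n X f c)"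

text \<open>
  The standard \<open>p\<close>-simplex is literally the front face of the standard \<open>(p+q)\<close>-simplex, so the
  front face of a singular simplex is a restriction. The back face is spanned by the last
  \<open>q+1\<close> vertices.
\<close>

definition front_face :: "nat \<Rightarrow> ((nat \<Rightarrow> real) \<Rightarrow> 'a) \<Rightarrow> (nat \<Rightarrow> real) \<Rightarrow> 'a" where
  "front_face p \<sigma> = restrict \<sigma> (standard_simplex p)"

definition back_face :: "nat \<Rightarrow> nat \<Rightarrow> ((nat \<Rightarrow> real) \<Rightarrow> 'a) \<Rightarrow> (nat \<Rightarrow> real) \<Rightarrow> 'a" where
  "back_face p q \<sigma> =
    restrict (\<lambda>x. \<sigma> (\<lambda>i. if i < p then 0 else x (i - p))) (standard_simplex q)"

definition cochain_cup ::
  "nat \<Rightarrow> nat \<Rightarrow> 'a topology \<Rightarrow> ('a, 'r::comm_ring_1) cochain \<Rightarrow> ('a, 'r) cochain \<Rightarrow> ('a, 'r) cochain"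
  where
  "cochain_cup p q X a b =
    (\<lambda>\<sigma>. if singular_simplex (p + q) X \<sigma> then a (front_face p \<sigma>) * b (back_face p q \<sigma>) else 0)"

definition cup_product ::
  "nat \<Rightarrow> nat \<Rightarrow> 'a topology \<Rightarrow>
   ('a, 'r::comm_ring_1) cochain set \<Rightarrow> ('a, 'r) cochain set \<Rightarrow> ('a, 'r) cochain set"
  where
  "cup_product p q X u v =
    (\<Union>a\<in>u. \<Union>b\<in>v. coboundaries (p + q) X #>\<^bsub>cocycle_group (p + q) X\<^esub> cochain_cup p q X a b)"

text \<open>
  \<open>iterated_cup X d u k\<close> is \<open>u 0 \<smile> u 1 \<smile> \<dots> \<smile> u k\<close>, where \<open>u i\<close> has degree \<open>d i\<close>.
\<close>

primrec iterated_cup ::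
  "'a topology \<Rightarrow> (nat \<Rightarrow> nat) \<Rightarrow> (nat \<Rightarrow> ('a, 'r::comm_ring_1) cochain set) \<Rightarrow> nat \<Rightarrow>
   ('a, 'r) cochain set"
  where
  "iterated_cup X d u 0 = u 0"
| "iterated_cup X d u (Suc j) =
     cup_product (\<Sum>i\<le>j. d i) (d (Suc j)) X (iterated_cup X d u j) (u (Suc j))"


section \<open>CW complexes\<close>

definition unit_disc :: "nat \<Rightarrow> (nat \<Rightarrow> real) set" where
  "unit_disc n = {x \<in> topspace (Euclidean_space n). (\<Sum>i<n. (x i)\<^sup>2) \<le> 1}"

definition open_unit_disc :: "nat \<Rightarrow> (nat \<Rightarrow> real) set" where
  "open_unit_disc n = {x \<in> topspace (Euclidean_space n). (\<Sum>i<n. (x i)\<^sup>2) < 1}"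

definition unit_disc_boundary :: "nat \<Rightarrow> (nat \<Rightarrow> real) set" where
  "unit_disc_boundary n = {x \<in> topspace (Euclidean_space n). (\<Sum>i<n. (x i)\<^sup>2) = 1}"

text \<open>
  A cell is given by a pair \<open>(n, \<Phi>)\<close> of its dimension and its characteristic map. The open cells
  are disjoint, so nothing is lost by taking a set of such pairs instead of an indexed family.
\<close>

definition CW_structure :: "'p topology \<Rightarrow> (nat \<times> ((nat \<Rightarrow> real) \<Rightarrow> 'p)) set \<Rightarrow> bool" where
  "CW_structure P \<E> \<longleftrightarrow>
    Hausdorff_space P \<and>
    (\<forall>(n, \<Phi>) \<in> \<E>.
       continuous_map (subtopology (Euclidean_space n) (unit_disc n)) P \<Phi> \<and>
       homeomorphic_map (subtopology (Euclidean_space n) (open_unit_disc n))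
         (subtopology P (\<Phi> ` open_unit_disc n)) \<Phi>) \<and>
    pairwise (\<lambda>(n, \<Phi>) (n', \<Phi>'). disjnt (\<Phi> ` open_unit_disc n) (\<Phi>' ` open_unit_disc n')) \<E> \<and>
    (\<Union>(n, \<Phi>) \<in> \<E>. \<Phi> ` open_unit_disc n) = topspace P \<and>
    (\<forall>(n, \<Phi>) \<in> \<E>. \<exists>\<F> \<subseteq> \<E>. finite \<F> \<and> (\<forall>(n', \<Phi>') \<in> \<F>. n' < n) \<and>
       \<Phi> ` unit_disc_boundary n \<subseteq> (\<Union>(n', \<Phi>') \<in> \<F>. \<Phi>' ` open_unit_disc n')) \<and>
    (\<forall>A \<subseteq> topspace P. closedin P A \<longleftrightarrow> (\<forall>(n, \<Phi>) \<in> \<E>. closedin P (A \<inter> \<Phi> ` unit_disc n)))"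

definition CW_complex_of_dim :: "nat \<Rightarrow> 'p topology \<Rightarrow> bool" where
  "CW_complex_of_dim m P \<longleftrightarrow>
    (\<exists>\<E>. CW_structure P \<E> \<and> (\<forall>(n, \<Phi>) \<in> \<E>. n \<le> m) \<and> (\<exists>(n, \<Phi>) \<in> \<E>. n = m))"


section \<open>The homotopic distance\<close>

text \<open>
  HOL cannot quantify over the carrier type of the CW complex \<open>P\<close> inside a definition, so
  \<open>P\<close> ranges over the CW complexes whose points are pairs of a function from points of
  simplices to \<open>X\<close> and a point of a simplex. This is no restriction. The (fat) geometric
  realisation of the singular complex of \<open>U \<subseteq> X\<close> has this type of points: a point
  is a pair \<open>(\<sigma>, t)\<close> of a singular simplex \<open>\<sigma>\<close> of \<open>U\<close> and an interior point \<open>t\<close> of its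
  standard simplex. As the realisation is weakly equivalent to \<open>U\<close>, cellular approximation
  shows that every map from an \<open>m\<close>-dimensional CW complex to \<open>U\<close> factors up to homotopy
  through the \<open>m\<close>-skeleton of the realisation, so the condition below for this one complex
  already implies it for all \<open>m\<close>-dimensional CW complexes of any type. Moreover, as fewer test
  complexes can only make the distance smaller, a lower bound for the distance as defined here
  is, even without this argument, a lower bound for the one with unrestricted \<open>P\<close>.
\<close>

type_synonym 'a realisation_point = "((nat \<Rightarrow> real) \<Rightarrow> 'a) \<times> (nat \<Rightarrow> real)"

definition m_homotopic_on ::
  "nat \<Rightarrow> 'a topology \<Rightarrow> 'b topology \<Rightarrow> 'a set \<Rightarrow> ('a \<Rightarrow> 'b) \<Rightarrow> ('a \<Rightarrow> 'b) \<Rightarrow> bool" where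
  "m_homotopic_on m X Y U f g \<longleftrightarrow>
    (\<forall>(P :: 'a realisation_point topology) \<phi>.
       CW_complex_of_dim m P \<and> continuous_map P (subtopology X U) \<phi> \<longrightarrow>
       homotopic_with (\<lambda>h. True) P Y (f \<circ> \<phi>) (g \<circ> \<phi>))"

text \<open>The infimum of the empty set in \<^typ>\<open>enat\<close> is \<open>\<infinity>\<close>.\<close>

definition homotopic_distance ::
  "nat \<Rightarrow> 'a topology \<Rightarrow> 'b topology \<Rightarrow> ('a \<Rightarrow> 'b) \<Rightarrow> ('a \<Rightarrow> 'b) \<Rightarrow> enat" where
  "homotopic_distance m X Y f g =
    Inf {enat k | k. \<exists>U :: nat \<Rightarrow> 'a set.
           (\<forall>i\<le>k. openin X (U i)) \<and> (\<Union>i\<le>k. U i) = topspace X \<and>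
           (\<forall>i\<le>k. m_homotopic_on m X Y (U i) f g)}"

end

theory Submission
  imports Defs
begin

text \<open>
  Suppose that \<open>X\<close> is covered by open sets \<open>U\<^sub>0, \<dots>, U\<^sub>k\<close> on which \<open>f\<close> and \<open>g\<close> become homotopic after
  composition with maps from \<open>m\<close>-dimensional CW complexes. The class \<open>(f,g)\<^sup>* u\<^sub>i\<close> then restricts to
  zero on \<open>U\<^sub>i\<close>, so it is represented by a cocycle that vanishes on the singular simplices of \<open>U\<^sub>i\<close>. The
  cup product of these cocycles vanishes on every simplex contained in some \<open>U\<^sub>i\<close>, and by
  subdivision such a cocycle is a coboundary (\<open>cocycle_vanishing_on_small_simplices\<close>). Hence
  \<open>(f,g)\<^sup>*(u\<^sub>0 \<smile> \<dots> \<smile> u\<^sub>k) = 0\<close>, contrary to the assumption.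

  The restriction to \<open>U\<^sub>i\<close> is the point where the dimension \<open>m\<close> enters
  (\<open>m_homotopic_pullback_coboundary\<close>). With arbitrary coefficients a cocycle is not determined up to
  coboundaries by its values on cycles, nor by its restrictions to finite complexes, so one test
  complex has to see all of \<open>U\<^sub>i\<close> at once. It is the \<open>m\<close>-skeleton of the fat geometric realisation of
  the singular complex of \<open>U\<^sub>i\<close>: it has one closed simplex for every singular simplex of dimension
  at most \<open>m\<close>, glued along faces, and a canonical map to \<open>U\<^sub>i\<close>. A homotopy between the two composites
  on this complex is the same as a family of homotopies from \<open>f \<circ> \<sigma>\<close> to \<open>g \<circ> \<sigma>\<close> compatible with
  faces. Through prism chains (\<open>prism_chains\<close>) it yields a chain homotopy from \<open>(f,f)\<close> to \<open>(f,g)\<close> in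
  degrees up to \<open>m\<close>, and \<open>(f,f)\<close> factors through the diagonal, on which \<open>u\<^sub>i\<close> vanishes.

  Most of the work is the proof that this skeleton is a CW complex (\<open>CW_structure_skeleton\<close>). Its
  points are pairs of a singular simplex and an interior point of a standard simplex. The Hausdorff
  property follows from explicit continuous functions that separate points
  (\<open>face_detector\<close>); given it, the other topological axioms follow from the compactness of the cells. The
  characteristic maps have discs as their domains, for which a radial homeomorphism from
  the disc to the simplex is used.
\<close>

section \<open>Cochains, cocycles and coboundaries\<close>

lemma cochain_eval_0 [simp]: "cochain_eval c 0 = 0"
  by (simp add: cochain_eval_def)

lemma cochain_eval_frag_of [simp]: "cochain_eval c (frag_of \<sigma>) = c \<sigma>"
  by (simp add: cochain_eval_def)

lemma cochain_eval_superset: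
  assumes "finite A" "Poly_Mapping.keys z \<subseteq> A"
  shows "cochain_eval c z = (\<Sum>\<sigma>\<in>A. of_int (Poly_Mapping.lookup z \<sigma>) * c \<sigma>)"
  unfolding cochain_eval_def
  by (rule sum.mono_neutral_left) (use assms in \<open>auto simp: in_keys_iff\<close>)

lemma cochain_eval_add: "cochain_eval c (a + b) = cochain_eval c a + cochain_eval c b"
proof -
  let ?A = "Poly_Mapping.keys a \<union> Poly_Mapping.keys b"
  have "cochain_eval c (a + b) = (\<Sum>\<sigma>\<in>?A. of_int (Poly_Mapping.lookup (a+b) \<sigma>) * c \<sigma>)"
    by (rule cochain_eval_superset) (use keys_add[of a b] in auto)
  moreover have "cochain_eval c a = (\<Sum>\<sigma>\<in>?A. of_int (Poly_Mapping.lookup a \<sigma>) * c \<sigma>)"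
    by (rule cochain_eval_superset) auto
  moreover have "cochain_eval c b = (\<Sum>\<sigma>\<in>?A. of_int (Poly_Mapping.lookup b \<sigma>) * c \<sigma>)"
    by (rule cochain_eval_superset) auto
  ultimately show ?thesis by (simp add: lookup_add algebra_simps sum.distrib)
qed

lemma cochain_eval_minus: "cochain_eval c (- a) = - cochain_eval c a"
  using cochain_eval_add[of c a "-a"] by (simp add: eq_neg_iff_add_eq_0 add.commute)

lemma cochain_eval_diff: "cochain_eval c (a - b) = cochain_eval c a - cochain_eval c b"
  using cochain_eval_add[of c a "-b"] by (simp add: cochain_eval_minus)

lemma cochain_eval_sum: "cochain_eval c (sum F A) = (\<Sum>i\<in>A. cochain_eval c (F i))"
  by (induction A rule: infinite_finite_induct) (auto simp: cochain_eval_add)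

lemma cochain_eval_sign:
  "cochain_eval c (frag_cmul ((-1) ^ k) a) = (-1) ^ k * cochain_eval c a"
  by (cases "even k") (auto simp: cochain_eval_minus)

lemma cochain_eval_add_left: "cochain_eval (\<lambda>\<sigma>. a \<sigma> + b \<sigma>) z = cochain_eval a z + cochain_eval b z"
  by (simp add: cochain_eval_def algebra_simps sum.distrib)

lemma cochain_eval_minus_left: "cochain_eval (\<lambda>\<sigma>. - a \<sigma>) z = - cochain_eval a z"
  by (simp add: cochain_eval_def algebra_simps sum_negf)

lemma cochain_eval_cong:
  assumes "\<And>\<sigma>. \<sigma> \<in> Poly_Mapping.keys z \<Longrightarrow> a \<sigma> = b \<sigma>"
  shows "cochain_eval a z = cochain_eval b z"
  using assms by (simp add: cochain_eval_def)

lemma cochain_eval_eq_0: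
  assumes "\<And>\<sigma>. \<sigma> \<in> Poly_Mapping.keys z \<Longrightarrow> c \<sigma> = 0"
  shows "cochain_eval c z = 0"
  using assms by (simp add: cochain_eval_def)

lemma additive_on_chains_eqI:
  assumes "\<And>\<sigma>. \<sigma> \<in> Poly_Mapping.keys z \<Longrightarrow> F (frag_of \<sigma>) = G (frag_of \<sigma>)"
    and "F 0 = G 0"
    and "\<And>a b. F (a - b) = F a - F b" "\<And>a b. G (a - b) = G a - G b"
  shows "F z = (G z :: 'r::comm_ring_1)"
  using order_refl[of "Poly_Mapping.keys z"]
proof (induction z rule: frag_induction)
  case (one x) then show ?case using assms(1) by blast
qed (use assms in auto)

lemma coboundary_eval:
  assumes "singular_chain (Suc n) X z"
  shows "cochain_eval (cochain_coboundary n X c) z = cochain_eval c (chain_boundary (Suc n) z)"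
proof (rule additive_on_chains_eqI[where F="cochain_eval (cochain_coboundary n X c)" 
        and G="\<lambda>z. cochain_eval c (chain_boundary (Suc n) z)"])
  fix \<sigma> assume "\<sigma> \<in> Poly_Mapping.keys z"
  with assms show "cochain_eval (cochain_coboundary n X c) (frag_of \<sigma>) =
      cochain_eval c (chain_boundary (Suc n) (frag_of \<sigma>))"
    by (auto simp: singular_chain_def cochain_coboundary_def)
qed (auto simp: cochain_eval_diff chain_boundary_diff)

lemma coboundary_simplex:
  assumes "singular_simplex (Suc n) X \<sigma>"
  shows "cochain_coboundary n X c \<sigma> = (\<Sum>k\<le>Suc n. (-1)^k * c (singular_face (Suc n) k \<sigma>))"
  using assms by (simp add: cochain_coboundary_def chain_boundary_of cochain_eval_sum cochain_eval_sign
      cochain_eval_add del: sum.atMost_Suc)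

lemma coboundary_add:
  "cochain_coboundary n X (\<lambda>\<sigma>. a \<sigma> + b \<sigma>) =
     (\<lambda>\<sigma>. cochain_coboundary n X a \<sigma> + cochain_coboundary n X b \<sigma>)"
  by (auto simp: cochain_coboundary_def cochain_eval_add_left)

lemma coboundary_minus:
  "cochain_coboundary n X (\<lambda>\<sigma>. - a \<sigma>) = (\<lambda>\<sigma>. - cochain_coboundary n X a \<sigma>)"
  by (auto simp: cochain_coboundary_def cochain_eval_minus_left)

lemma coboundary_0 [simp]: "cochain_coboundary n X (\<lambda>\<sigma>. 0) = (\<lambda>\<sigma>. 0)"
  by (auto simp: cochain_coboundary_def cochain_eval_def)

lemma coboundary_in_cochains: "cochain_coboundary n X c \<in> cochains (Suc n) X"
  by (auto simp: cochains_def cochain_coboundary_def)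

lemma coboundary_coboundary:
  "cochain_coboundary (Suc n) X (cochain_coboundary n X c) = (\<lambda>\<sigma>. 0)"
proof
  fix \<sigma>
  show "cochain_coboundary (Suc n) X (cochain_coboundary n X c) \<sigma> = 0"
  proof (cases "singular_simplex (Suc (Suc n)) X \<sigma>")
    case True
    then have ch: "singular_chain (Suc (Suc n)) X (frag_of \<sigma>)"
      by (simp add: singular_chain_of)
    have "cochain_coboundary (Suc n) X (cochain_coboundary n X c) \<sigma> =
       cochain_eval (cochain_coboundary n X c) (chain_boundary (Suc (Suc n)) (frag_of \<sigma>))"
      using True by (simp add: cochain_coboundary_def)
    also have "\<dots> = cochain_eval c (chain_boundary (Suc n) (chain_boundary (Suc (Suc n)) (frag_of \<sigma>)))"
      by (rule coboundary_eval) (use singular_chain_boundary_alt[OF ch] in simp)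
    also have "\<dots> = 0"
      using chain_boundary_boundary_alt[OF ch] by simp
    finally show ?thesis .
  qed (simp add: cochain_coboundary_def)
qed

lemma cochains_zero [simp]: "(\<lambda>\<sigma>. 0) \<in> cochains n X"
  by (simp add: cochains_def)
lemma cochains_add: "a \<in> cochains n X \<Longrightarrow> b \<in> cochains n X \<Longrightarrow> (\<lambda>\<sigma>. a \<sigma> + b \<sigma>) \<in> cochains n X"
  by (simp add: cochains_def)
lemma cochains_minus: "a \<in> cochains n X \<Longrightarrow> (\<lambda>\<sigma>. - a \<sigma>) \<in> cochains n X"
  by (simp add: cochains_def)

lemma cocycles_add: "a \<in> cocycles n X \<Longrightarrow> b \<in> cocycles n X \<Longrightarrow> (\<lambda>\<sigma>. a \<sigma> + b \<sigma>) \<in> cocycles n X"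
  by (simp add: cocycles_def cochains_add coboundary_add)
lemma cocycles_minus: "a \<in> cocycles n X \<Longrightarrow> (\<lambda>\<sigma>. - a \<sigma>) \<in> cocycles n X"
  by (simp add: cocycles_def cochains_minus coboundary_minus)
lemma cocycles_diff: "a \<in> cocycles n X \<Longrightarrow> b \<in> cocycles n X \<Longrightarrow> (\<lambda>\<sigma>. a \<sigma> - b \<sigma>) \<in> cocycles n X"
  using cocycles_add[of a n X "\<lambda>\<sigma>. - b \<sigma>"] cocycles_minus[of b n X] by simp

lemma coboundaries_zero [simp]: "(\<lambda>\<sigma>. 0) \<in> coboundaries n X"
  by (cases n) (auto simp: coboundaries_def intro!: image_eqI[of _ _ "\<lambda>\<sigma>. 0"])
lemma coboundaries_Suc_iff:
  "b \<in> coboundaries (Suc n) X \<longleftrightarrow> (\<exists>s\<in>cochains n X. b = cochain_coboundary n X s)"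
  by (auto simp: coboundaries_def)
lemma coboundaries_0_iff: "b \<in> coboundaries 0 X \<longleftrightarrow> b = (\<lambda>\<sigma>. 0)"
  by (auto simp: coboundaries_def)

lemma coboundaries_add:
  assumes "a \<in> coboundaries n X" "b \<in> coboundaries n X"
  shows "(\<lambda>\<sigma>. a \<sigma> + b \<sigma>) \<in> coboundaries n X"
proof (cases n)
  case (Suc p)
  with assms obtain s t where "s \<in> cochains p X" "a = cochain_coboundary p X s"
     "t \<in> cochains p X" "b = cochain_coboundary p X t"
    by (auto simp: coboundaries_Suc_iff)
  then show ?thesis
    unfolding Suc coboundaries_Suc_iff
    by (intro bexI[of _ "\<lambda>\<sigma>. s \<sigma> + t \<sigma>"]) (auto simp: coboundary_add cochains_add)
qed (use assms in \<open>auto simp: coboundaries_0_iff\<close>)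

lemma coboundaries_minus:
  assumes "a \<in> coboundaries n X"
  shows "(\<lambda>\<sigma>. - a \<sigma>) \<in> coboundaries n X"
proof (cases n)
  case (Suc p)
  with assms obtain s where "s \<in> cochains p X" "a = cochain_coboundary p X s"
    by (auto simp: coboundaries_Suc_iff)
  then show ?thesis
    unfolding Suc coboundaries_Suc_iff
    by (intro bexI[of _ "\<lambda>\<sigma>. - s \<sigma>"]) (auto simp: coboundary_minus cochains_minus)
qed (use assms in \<open>auto simp: coboundaries_0_iff\<close>)

lemma coboundaries_subset_cocycles: "coboundaries n X \<subseteq> cocycles n X"
  by (cases n) (auto simp: coboundaries_0_iff coboundaries_Suc_iff cocycles_def
      coboundary_in_cochains coboundary_coboundary)

lemma cocycle_eval_boundary:
  assumes "c \<in> cocycles n X" "singular_chain (Suc n) X z"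
  shows "cochain_eval c (chain_boundary (Suc n) z) = 0"
  using coboundary_eval[OF assms(2), of c] assms(1) by (simp add: cocycles_def cochain_eval_def)

lemma pullback_in_cochains: "cochain_pullback n X f c \<in> cochains n X"
  by (auto simp: cochains_def cochain_pullback_def)

lemma pullback_add:
  "cochain_pullback n X f (\<lambda>\<sigma>. a \<sigma> + b \<sigma>) = (\<lambda>\<sigma>. cochain_pullback n X f a \<sigma> + cochain_pullback n X f b \<sigma>)"
  by (auto simp: cochain_pullback_def)

lemma singular_face_pushforward:
  assumes "k \<le> Suc n"
  shows "singular_face (Suc n) k (simplex_map (Suc n) f \<sigma>) = simplex_map n f (singular_face (Suc n) k \<sigma>)"
  using singular_face_simplex_map[of "Suc n" k f \<sigma>] assms
  by (simp add: simplex_map_def singular_face_def cong: restrict_cong)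

lemma coboundary_pullback:
  assumes "continuous_map X Y f"
  shows "cochain_coboundary n X (cochain_pullback n X f c) =
         cochain_pullback (Suc n) X f (cochain_coboundary n Y c)"
proof
  fix \<sigma>
  show "cochain_coboundary n X (cochain_pullback n X f c) \<sigma> =
         cochain_pullback (Suc n) X f (cochain_coboundary n Y c) \<sigma>"
  proof (cases "singular_simplex (Suc n) X \<sigma>")
    case True
    then have Y: "singular_simplex (Suc n) Y (simplex_map (Suc n) f \<sigma>)"
      using assms singular_simplex_simplex_map by blast
    have "singular_simplex n X (singular_face (Suc n) k \<sigma>)" if "k \<le> Suc n" for k
      using singular_simplex_singular_face[OF True _ that] by simp
    then show ?thesis
      using True singular_face_pushforward[of _ n f \<sigma>]
      by (simp add: coboundary_simplex[OF True] cochain_pullback_def coboundary_simplex[OF Y] del: sum.atMost_Suc)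
  qed (simp add: cochain_coboundary_def cochain_pullback_def)
qed

lemma pullback_cocycles:
  assumes "continuous_map X Y f" "c \<in> cocycles n Y"
  shows "cochain_pullback n X f c \<in> cocycles n X"
proof -
  have "cochain_coboundary n X (cochain_pullback n X f c) = (\<lambda>\<sigma>. 0)"
    using assms(2) unfolding coboundary_pullback[OF assms(1)] by (auto simp: cocycles_def cochain_pullback_def)
  then show ?thesis by (simp add: cocycles_def pullback_in_cochains)
qed

lemma pullback_coboundaries:
  assumes "continuous_map X Y f" "c \<in> coboundaries n Y"
  shows "cochain_pullback n X f c \<in> coboundaries n X"
proof (cases n)
  case 0
  with assms show ?thesis by (auto simp: coboundaries_0_iff cochain_pullback_def)
next
  case (Suc p)
  then obtain s where "c = cochain_coboundary p Y s"
    using assms by (auto simp: coboundaries_Suc_iff)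
  then show ?thesis
    unfolding Suc coboundaries_Suc_iff
    by (auto simp: coboundary_pullback[OF assms(1), symmetric] pullback_in_cochains
        intro!: bexI[of _ "cochain_pullback p X f s"])
qed


section \<open>Cup products\<close>

text \<open>
  The affine inclusion of the standard \<open>q\<close>-simplex as the face of the standard \<open>(p+q)\<close>-simplex
  spanned by the last \<open>q+1\<close> vertices. With a name for it, the simplicial identities for front and
  back faces become identities between maps of simplices.
\<close>

definition back_inclusion :: "nat \<Rightarrow> (nat \<Rightarrow> real) \<Rightarrow> nat \<Rightarrow> real" where
  "back_inclusion p x = (\<lambda>i. if i < p then 0 else x (i - p))"

lemma back_face_alt: "back_face p q \<sigma> = restrict (\<sigma> \<circ> back_inclusion p) (standard_simplex q)"
  by (simp add: back_face_def back_inclusion_def o_def)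

lemma back_inclusion_simplex:
  assumes "x \<in> standard_simplex q"
  shows "back_inclusion p x \<in> standard_simplex (p + q)"
proof -
  have "(\<Sum>i\<le>p+q. back_inclusion p x i) = (\<Sum>i\<in>{p..p+q}. x (i - p))"
    by (rule sum.mono_neutral_cong_right) (auto simp: back_inclusion_def)
  also have "\<dots> = sum x {..q}"
    by (rule sum.reindex_bij_witness[of _ "\<lambda>i. i + p" "\<lambda>i. i - p"]) auto
  finally show ?thesis
    using assms by (auto simp: standard_simplex_def back_inclusion_def)
qed

lemma singular_simplex_front_face:
  assumes "singular_simplex (p + q) X \<sigma>"
  shows "singular_simplex p X (front_face p \<sigma>)"
  using assms standard_simplex_mono[of p "p+q"]
  by (auto simp: singular_simplex_def front_face_def intro: continuous_map_from_subtopology_mono)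

lemma singular_simplex_back_face:
  assumes "singular_simplex (p + q) X \<sigma>"
  shows "singular_simplex q X (back_face p q \<sigma>)"
proof -
  have "continuous_map (powertop_real UNIV) euclideanreal (\<lambda>x. back_inclusion p x i)" for i
    by (auto simp: back_inclusion_def intro: continuous_map_product_projection)
  then have "continuous_map (subtopology (powertop_real UNIV) (standard_simplex q))
         (subtopology (powertop_real UNIV) (standard_simplex (p + q))) (back_inclusion p)"
    by (auto simp: continuous_map_in_subtopology continuous_map_componentwise_UNIV back_inclusion_simplex
        intro!: continuous_map_from_subtopology)
  then show ?thesis
    using assms by (auto simp: singular_simplex_def back_face_alt intro: continuous_map_compose)
qed

text \<open>
  Omitting the vertex \<open>i\<close> of a \<open>(p+q+1)\<close>-simplex before cutting it into a front and a back face
  affects only the front if \<open>i \<le> p\<close> and only the back if \<open>i > p\<close>. The next four lemmas express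
  this; the Leibniz rule for the coboundary is the corresponding splitting of the alternating sum.
\<close>

lemma front_face_singular_face:
  assumes "i \<le> Suc p"
  shows "front_face p (singular_face (Suc (p + q)) i \<sigma>) = singular_face (Suc p) i (front_face (Suc p) \<sigma>)"
  using standard_simplex_mono[of p "p+q"] simplical_face_in_standard_simplex[of "Suc p" i] assms
  by (auto simp: front_face_def singular_face_def restrict_def intro!: ext)

lemma back_face_singular_face_low:
  assumes "i \<le> p"
  shows "back_face p q (singular_face (Suc (p + q)) i \<sigma>) = back_face (Suc p) q \<sigma>"
proof -
  have "simplical_face i (back_inclusion p x) = back_inclusion (Suc p) x" for x
    using assms by (auto simp: simplical_face_def back_inclusion_def fun_eq_iff)
  then show ?thesis
    by (auto simp: back_face_alt singular_face_def restrict_def back_inclusion_simplex intro!: ext)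
qed

lemma front_face_singular_face_high:
  "front_face p (singular_face (Suc (p + q)) (Suc p + l) \<sigma>) = front_face p \<sigma>"
proof -
  have "simplical_face (Suc p + l) x = x" if "x \<in> standard_simplex p" for x
    using that by (auto simp: simplical_face_def standard_simplex_def fun_eq_iff)
  then show ?thesis
    using standard_simplex_mono[of p "p+q"]
    by (auto simp: front_face_def singular_face_def restrict_def intro!: ext)
qed

lemma back_face_singular_face:
  assumes "l \<le> Suc q"
  shows "back_face p q (singular_face (Suc (p + q)) (p + l) \<sigma>) = singular_face (Suc q) l (back_face p (Suc q) \<sigma>)"
proof -
  have "simplical_face (p + l) (back_inclusion p x) = back_inclusion p (simplical_face l x)" for x
    by (auto simp: simplical_face_def back_inclusion_def fun_eq_iff)
  then show ?thesis
    using simplical_face_in_standard_simplex[of "Suc q" l] assms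
    by (auto simp: back_face_alt singular_face_def restrict_def back_inclusion_simplex intro!: ext)
qed

lemma singular_face_last_front_face:
  "singular_face (Suc p) (Suc p) (front_face (Suc p) \<sigma>) = front_face p \<sigma>"
  using front_face_singular_face[of "Suc p" p 0 \<sigma>] front_face_singular_face_high[of p 0 0 \<sigma>] by simp

lemma singular_face_first_back_face:
  "singular_face (Suc q) 0 (back_face p (Suc q) \<sigma>) = back_face (Suc p) q \<sigma>"
  using back_face_singular_face[of 0 q p \<sigma>] back_face_singular_face_low[of p p q \<sigma>] by simp

lemma cup_in_cochains: "cochain_cup p q X a b \<in> cochains (p + q) X"
  by (auto simp: cochains_def cochain_cup_def)

text \<open>
  The Leibniz rule. The terms with \<open>i \<le> p\<close> give \<open>\<delta>a \<smile> b\<close> without its last summand, those with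
  \<open>i > p\<close> give \<open>a \<smile> \<delta>b\<close> without its first summand, up to the sign \<open>(-1)\<^sup>p\<close>. Both missing summands are
  \<open>\<plusminus>a(v\<^sub>0\<dots>v\<^sub>p) b(v\<^sub>p\<^sub>+\<^sub>1\<dots>v\<^sub>p\<^sub>+\<^sub>q\<^sub>+\<^sub>1)\<close>, with opposite signs, so they cancel.
\<close>

lemma coboundary_cup:
  "cochain_coboundary (p + q) X (cochain_cup p q X a b) =
     (\<lambda>\<sigma>. cochain_cup (Suc p) q X (cochain_coboundary p X a) b \<sigma> +
          (-1) ^ p * cochain_cup p (Suc q) X a (cochain_coboundary q X b) \<sigma>)"
proof
  fix \<sigma>
  show "cochain_coboundary (p + q) X (cochain_cup p q X a b) \<sigma> =
     cochain_cup (Suc p) q X (cochain_coboundary p X a) b \<sigma> +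
          (-1) ^ p * cochain_cup p (Suc q) X a (cochain_coboundary q X b) \<sigma>"
  proof (cases "singular_simplex (Suc (p + q)) X \<sigma>")
    case True
    note [simp del] = sum.atMost_Suc
    let ?d = "\<lambda>i. singular_face (Suc (p + q)) i \<sigma>"
    define af where "af i = a (singular_face (Suc p) i (front_face (Suc p) \<sigma>))" for i
    define bf where "bf l = b (singular_face (Suc q) l (back_face p (Suc q) \<sigma>))" for l
    define a0 b0 where "a0 = a (front_face p \<sigma>)" and "b0 = b (back_face (Suc p) q \<sigma>)"
    define F where "F i = (-1) ^ i * cochain_cup p q X a b (?d i)" for i
    have d: "singular_simplex (p + q) X (?d i)" if "i \<le> Suc (p + q)" for i
      using singular_simplex_singular_face[OF True _ that] by simp
    have lo: "F i = (-1) ^ i * af i * b0" if "i \<le> p" for i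
      using that d[of i]
      by (simp add: F_def cochain_cup_def front_face_singular_face back_face_singular_face_low af_def b0_def)
    have hi: "F (Suc (p + l)) = (-1) ^ (Suc (p + l)) * (a0 * bf (Suc l))" if "l \<le> q" for l
      using that d[of "Suc p + l"] back_face_singular_face[of "Suc l" q p \<sigma>]
         front_face_singular_face_high[of p q l \<sigma>]
      by (simp add: F_def cochain_cup_def a0_def bf_def)
    have "cochain_coboundary (p + q) X (cochain_cup p q X a b) \<sigma> = (\<Sum>i\<le>p + Suc q. F i)"
      by (simp add: coboundary_simplex[OF True] F_def)
    also have "\<dots> = (\<Sum>i\<le>p. F i) + (\<Sum>i=Suc p..p + Suc q. F i)"
      by (rule sum_up_index_split)
    also have "(\<Sum>i=Suc p..p + Suc q. F i) = (\<Sum>l\<le>q. F (Suc p + l))"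
      by (rule sum.reindex_bij_witness[of _ "\<lambda>l. Suc p + l" "\<lambda>i. i - Suc p"]) auto
    also have "\<dots> = (-1) ^ p * (a0 * (\<Sum>l\<le>q. (-1) ^ (Suc l) * bf (Suc l)))"
      by (simp add: hi sum_distrib_left power_add mult_ac)
    also have "(\<Sum>l\<le>q. (-1) ^ (Suc l) * bf (Suc l)) = (\<Sum>l\<le>Suc q. (-1) ^ l * bf l) - b0"
      by (subst sum.atMost_Suc_shift) (simp add: bf_def singular_face_first_back_face b0_def)
    also have "(\<Sum>i\<le>p. F i) = (\<Sum>i\<le>p. (-1) ^ i * af i) * b0"
      by (simp add: lo sum_distrib_right)
    also have "(\<Sum>i\<le>p. (-1) ^ i * af i) = (\<Sum>i\<le>Suc p. (-1) ^ i * af i) + (-1) ^ p * a0"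
      by (simp add: sum.atMost_Suc af_def singular_face_last_front_face a0_def)
    also have "(\<Sum>i\<le>Suc p. (-1) ^ i * af i) = cochain_coboundary p X a (front_face (Suc p) \<sigma>)"
      using singular_simplex_front_face[of "Suc p" q X \<sigma>] True by (simp add: coboundary_simplex af_def)
    also have "(\<Sum>l\<le>Suc q. (-1) ^ l * bf l) = cochain_coboundary q X b (back_face p (Suc q) \<sigma>)"
      using singular_simplex_back_face[of p "Suc q" X \<sigma>] True by (simp add: coboundary_simplex bf_def)
    finally show ?thesis
      using True by (simp add: cochain_cup_def a0_def b0_def algebra_simps)
  qed (simp add: cochain_coboundary_def cochain_cup_def)
qed

lemma cup_zero_left [simp]: "cochain_cup p q X (\<lambda>\<sigma>. 0) b = (\<lambda>\<sigma>. 0)"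
  and cup_zero_right [simp]: "cochain_cup p q X a (\<lambda>\<sigma>. 0) = (\<lambda>\<sigma>. 0)"
  by (auto simp: cochain_cup_def)

lemma cup_add_left: "cochain_cup p q X (\<lambda>\<sigma>. a \<sigma> + a' \<sigma>) b = (\<lambda>\<sigma>. cochain_cup p q X a b \<sigma> + cochain_cup p q X a' b \<sigma>)"
  and cup_add_right: "cochain_cup p q X a (\<lambda>\<sigma>. b \<sigma> + b' \<sigma>) = (\<lambda>\<sigma>. cochain_cup p q X a b \<sigma> + cochain_cup p q X a b' \<sigma>)"
  by (auto simp: cochain_cup_def algebra_simps)

lemma cup_cocycles:
  assumes "a \<in> cocycles p X" "b \<in> cocycles q X"
  shows "cochain_cup p q X a b \<in> cocycles (p + q) X"
  using assms by (simp add: cocycles_def cup_in_cochains coboundary_cup)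

lemma cup_coboundary_left:
  assumes "a \<in> coboundaries p X" "b \<in> cocycles q X"
  shows "cochain_cup p q X a b \<in> coboundaries (p + q) X"
proof (cases p)
  case 0
  with assms show ?thesis by (simp add: coboundaries_0_iff)
next
  case (Suc r)
  then obtain s where "a = cochain_coboundary r X s"
    using assms by (auto simp: coboundaries_Suc_iff)
  moreover have "cochain_coboundary q X b = (\<lambda>\<sigma>. 0)"
    using assms by (simp add: cocycles_def)
  ultimately show ?thesis
    using Suc coboundary_cup[of r q X s b]
    by (auto simp: coboundaries_Suc_iff cup_in_cochains intro!: bexI[of _ "cochain_cup r q X s b"])
qed

lemma cup_coboundary_right:
  assumes "a \<in> cocycles p X" "b \<in> coboundaries q X"
  shows "cochain_cup p q X a b \<in> coboundaries (p + q) X"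
proof (cases q)
  case 0
  with assms show ?thesis by (simp add: coboundaries_0_iff)
next
  case (Suc r)
  then obtain s where s: "b = cochain_coboundary r X s"
    using assms by (auto simp: coboundaries_Suc_iff)
  have "cochain_coboundary p X a = (\<lambda>\<sigma>. 0)"
    using assms by (simp add: cocycles_def)
  then have *: "cochain_coboundary (p + r) X (cochain_cup p r X a s) =
      (\<lambda>\<sigma>. (-1) ^ p * cochain_cup p q X a b \<sigma>)"
    using coboundary_cup[of p r X a s] Suc s by simp
  show ?thesis
  proof (cases "even p")
    case True
    then show ?thesis
      using * Suc by (auto simp: coboundaries_Suc_iff cup_in_cochains intro!: bexI[of _ "cochain_cup p r X a s"])
  next
    case False
    then have "cochain_coboundary (p + r) X (cochain_cup p r X a s) \<in> coboundaries (p + q) X"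
      using Suc by (auto simp: coboundaries_Suc_iff cup_in_cochains)
    from coboundaries_minus[OF this] show ?thesis
      using * False by simp
  qed
qed

lemma pullback_cup:
  assumes "continuous_map X Y f"
  shows "cochain_pullback (p + q) X f (cochain_cup p q Y a b) =
         cochain_cup p q X (cochain_pullback p X f a) (cochain_pullback q X f b)"
proof
  fix \<sigma>
  show "cochain_pullback (p + q) X f (cochain_cup p q Y a b) \<sigma> =
         cochain_cup p q X (cochain_pullback p X f a) (cochain_pullback q X f b) \<sigma>"
  proof (cases "singular_simplex (p + q) X \<sigma>")
    case True
    have "front_face p (simplex_map (p + q) f \<sigma>) = simplex_map p f (front_face p \<sigma>)"
      using standard_simplex_mono[of p "p+q"]
      by (auto simp: front_face_def simplex_map_def restrict_def fun_eq_iff)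
    moreover have "back_face p q (simplex_map (p + q) f \<sigma>) = simplex_map q f (back_face p q \<sigma>)"
      by (auto simp: back_face_alt simplex_map_def restrict_def back_inclusion_simplex intro!: ext)
    ultimately show ?thesis
      using True assms
      by (simp add: cochain_pullback_def cochain_cup_def singular_simplex_front_face
          singular_simplex_back_face singular_simplex_simplex_map[of "p+q" X])
  qed (simp add: cochain_pullback_def cochain_cup_def)
qed

section \<open>Cocycles that vanish on small simplices\<close>

lemma singular_chain_iterated_subdivision:
  assumes "singular_chain p X c"
  shows "singular_chain p X ((singular_subdivision p ^^ i) c)"
  by (induction i) (auto simp: assms singular_chain_singular_subdivision)

lemma chain_boundary_iterated_subdivision:
  assumes "singular_chain p X c"
  shows "chain_boundary p ((singular_subdivision p ^^ i) c) =
         (singular_subdivision (p - Suc 0) ^^ i) (chain_boundary p c)"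
proof (induction i)
  case (Suc i)
  then show ?case
    using chain_boundary_singular_subdivision[OF singular_chain_iterated_subdivision[OF assms, of i]] by simp
qed simp

text \<open>
  This is what is needed of the theorem that the chains subordinate to an open cover have the
  cohomology of all chains. Let \<open>T\<close> be a natural chain homotopy from the identity to barycentric
  subdivision \<open>sd\<close>. As \<open>z\<close> vanishes on boundaries, applying it to
  \<open>\<partial>T + T\<partial> = sd - 1\<close> and summing over \<open>\<sigma>, sd \<sigma>, \<dots>, sd\<^sup>M\<^sup>-\<^sup>1 \<sigma>\<close> telescopes to
  \<open>\<Sum>\<^sub>i z(T sd\<^sup>i \<partial>\<sigma>) = z(sd\<^sup>M \<sigma>) - z(\<sigma>)\<close>, and \<open>z(sd\<^sup>M \<sigma>) = 0\<close> for large \<open>M\<close>. The left side is an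
  alternating sum over the faces \<open>\<tau>\<close> of \<open>\<sigma>\<close>, and for each face the terms \<open>z(T sd\<^sup>i \<tau>)\<close> vanish for large \<open>i\<close>,
  because \<open>T\<close> preserves smallness. Cutting the sum for \<open>\<tau>\<close> off at a bound \<open>m \<tau>\<close> that depends on \<open>\<tau>\<close>
  alone gives a cochain whose coboundary is \<open>z\<close> up to sign.
\<close>

lemma cocycle_vanishing_on_small_simplices:
  assumes z: "z \<in> cocycles n X"
    and op: "\<And>V. V \<in> \<C> \<Longrightarrow> openin X V" and cov: "topspace X \<subseteq> \<Union>\<C>"
    and van: "\<And>V \<sigma>. \<lbrakk>V \<in> \<C>; singular_simplex n (subtopology X V) \<sigma>\<rbrakk> \<Longrightarrow> z \<sigma> = 0"
  shows "z \<in> coboundaries n X"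
proof -
  obtain T where T0: "\<And>p. T p 0 = (0 :: 'a chain)"
    and Tdiff: "\<And>p c1 c2. T p (c1 - c2) = T p c1 - T p c2"
    and Tch: "\<And>p X c. singular_chain p X c \<Longrightarrow> singular_chain (Suc p) X (T p c)"
    and T: "\<And>p X c. singular_chain p X c \<Longrightarrow>
       chain_boundary (Suc p) (T p c) + T (p - Suc 0) (chain_boundary p c) = singular_subdivision p c - c"
    by (rule chain_homotopic_singular_subdivision) blast
  let ?sd = "\<lambda>p i. singular_subdivision p ^^ i"
  define small where "small p c \<longleftrightarrow>
      (\<forall>\<sigma>\<in>Poly_Mapping.keys c. \<exists>V\<in>\<C>. singular_simplex p (subtopology X V) \<sigma>)" for p and c :: "'a chain"
  have eventually_small: "\<exists>N. \<forall>i\<ge>N. small p (?sd p i c)" if c: "singular_chain p X c" for p c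
  proof -
    obtain N where N: "\<And>i f. \<lbrakk>N \<le> i; f \<in> Poly_Mapping.keys (?sd p i c)\<rbrakk>
        \<Longrightarrow> \<exists>V\<in>\<C>. f \<in> standard_simplex p \<rightarrow> V"
      using sufficient_iterated_singular_subdivision_exists[OF op cov c] by blast
    have "small p (?sd p i c)" if "N \<le> i" for i
      unfolding small_def
    proof
      fix f assume f: "f \<in> Poly_Mapping.keys (?sd p i c)"
      then have "singular_simplex p X f"
        using singular_chain_iterated_subdivision[OF c, of i] by (auto simp: singular_chain_def)
      with N[OF that f] show "\<exists>V\<in>\<C>. singular_simplex p (subtopology X V) f"
        by (auto simp: singular_simplex_subtopology)
    qed
    then show ?thesis by blast
  qed
  have z_small: "cochain_eval z c = 0" if "small n c" for c
    using that van by (auto simp: small_def intro!: cochain_eval_eq_0)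
  have telescope: "(\<Sum>i<M. cochain_eval z (T (n - Suc 0) (?sd (n - Suc 0) i (chain_boundary n (frag_of \<sigma>))))) = - z \<sigma>"
    if \<sigma>: "singular_simplex n X \<sigma>" and M: "small n (?sd n M (frag_of \<sigma>))" for \<sigma> M
  proof -
    have ch: "singular_chain n X (frag_of \<sigma>)"
      using \<sigma> by (simp add: singular_chain_of)
    have step: "cochain_eval z (T (n - Suc 0) (?sd (n - Suc 0) i (chain_boundary n (frag_of \<sigma>)))) =
       cochain_eval z (?sd n (Suc i) (frag_of \<sigma>)) - cochain_eval z (?sd n i (frag_of \<sigma>))" for i
    proof -
      let ?c = "?sd n i (frag_of \<sigma>)"
      have c: "singular_chain n X ?c"
        by (rule singular_chain_iterated_subdivision[OF ch])
      have "cochain_eval z (chain_boundary (Suc n) (T n ?c)) = 0"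
        by (rule cocycle_eval_boundary[OF z Tch[OF c]])
      moreover have "cochain_eval z (chain_boundary (Suc n) (T n ?c)) +
          cochain_eval z (T (n - Suc 0) (chain_boundary n ?c)) =
          cochain_eval z (singular_subdivision n ?c) - cochain_eval z ?c"
        using arg_cong[OF T[OF c], of "cochain_eval z"] by (simp add: cochain_eval_add cochain_eval_diff)
      ultimately show ?thesis
        by (simp add: chain_boundary_iterated_subdivision[OF ch])
    qed
    have "(\<Sum>i<M. cochain_eval z (T (n - Suc 0) (?sd (n - Suc 0) i (chain_boundary n (frag_of \<sigma>))))) =
      cochain_eval z (?sd n M (frag_of \<sigma>)) - cochain_eval z (?sd n 0 (frag_of \<sigma>))"
      unfolding step by (rule sum_lessThan_telescope)
    then show ?thesis
      using z_small[OF M] by simp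
  qed
  show ?thesis
  proof (cases n)
    case 0
    have "z \<sigma> = 0" if \<sigma>: "singular_simplex n X \<sigma>" for \<sigma>
    proof -
      obtain M where "small n (?sd n M (frag_of \<sigma>))"
        using eventually_small[of n "frag_of \<sigma>"] \<sigma> by (auto simp: singular_chain_of)
      from telescope[OF \<sigma> this] show ?thesis
        by (simp add: 0 chain_boundary_def singular_subdivision_power_0 T0)
    qed
    then show ?thesis
      using z 0 by (auto simp: coboundaries_0_iff cocycles_def cochains_def)
  next
    case (Suc p)
    have zT: "cochain_eval z (T p c) = 0" if "small p c" for c
    proof -
      have "Poly_Mapping.keys c \<subseteq> {\<sigma>. \<exists>V\<in>\<C>. singular_simplex p (subtopology X V) \<sigma>}"
        using that by (auto simp: small_def)
      then show ?thesis
      proof (induction c rule: frag_induction)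
        case (one \<sigma>)
        then obtain V where V: "V \<in> \<C>" "singular_chain p (subtopology X V) (frag_of \<sigma>)"
          by (auto simp: singular_chain_of)
        from Tch[OF V(2)] V(1) show ?case
          by (intro z_small) (auto simp: small_def singular_chain_def Suc)
      qed (auto simp: T0 Tdiff cochain_eval_diff)
    qed
    have "\<forall>\<tau>. \<exists>N. singular_simplex p X \<tau> \<longrightarrow> (\<forall>i\<ge>N. small p (?sd p i (frag_of \<tau>)))"
      using eventually_small by (metis singular_chain_of)
    then obtain m where m: "\<And>\<tau> i. \<lbrakk>singular_simplex p X \<tau>; m \<tau> \<le> i\<rbrakk> \<Longrightarrow> small p (?sd p i (frag_of \<tau>))"
      by metis
    \<comment> \<open>The cut-off depends on the simplex \<open>\<tau>\<close> only, so that \<open>b\<close> is a cochain; any later cut-off gives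
        the same value.\<close>
    define b where "b \<tau> = (if singular_simplex p X \<tau>
        then - (\<Sum>i<m \<tau>. cochain_eval z (T p (?sd p i (frag_of \<tau>)))) else 0)" for \<tau>
    have b: "b \<tau> = - (\<Sum>i<M. cochain_eval z (T p (?sd p i (frag_of \<tau>))))"
      if "singular_simplex p X \<tau>" "m \<tau> \<le> M" for \<tau> M
    proof -
      have "(\<Sum>i<m \<tau>. cochain_eval z (T p (?sd p i (frag_of \<tau>)))) =
            (\<Sum>i<M. cochain_eval z (T p (?sd p i (frag_of \<tau>))))"
        by (rule sum.mono_neutral_left) (use that in \<open>auto intro!: zT m\<close>)
      then show ?thesis using that by (simp add: b_def)
    qed
    have "cochain_coboundary p X b = z"
    proof
      fix \<sigma>
      show "cochain_coboundary p X b \<sigma> = z \<sigma>"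
      proof (cases "singular_simplex (Suc p) X \<sigma>")
        case True
        let ?K = "Poly_Mapping.keys (chain_boundary (Suc p) (frag_of \<sigma>))"
        have ch: "singular_chain (Suc p) X (frag_of \<sigma>)"
          using True by (simp add: singular_chain_of)
        have K: "singular_simplex p X \<tau>" if "\<tau> \<in> ?K" for \<tau>
          using singular_chain_boundary_alt[OF ch] that by (auto simp: singular_chain_def)
        obtain N where N: "\<And>i. N \<le> i \<Longrightarrow> small n (?sd n i (frag_of \<sigma>))"
          using eventually_small[OF ch] Suc by auto
        \<comment> \<open>One cut-off that is late enough for \<open>\<sigma>\<close> and for all its faces.\<close>
        define M where "M = N + (\<Sum>\<tau>\<in>?K. m \<tau>)"
        have mM: "m \<tau> \<le> M" if "\<tau> \<in> ?K" for \<tau>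
          using member_le_sum[of \<tau> ?K m] that by (auto simp: M_def)
        have lin: "cochain_eval (\<lambda>\<tau>. - (\<Sum>i<M. cochain_eval z (T p (?sd p i (frag_of \<tau>))))) c =
                   - (\<Sum>i<M. cochain_eval z (T p (?sd p i c)))" for c
          by (rule additive_on_chains_eqI[where G="\<lambda>c. - (\<Sum>i<M. cochain_eval z (T p (?sd p i c)))"])
             (auto simp: singular_subdivision_power_0 T0 singular_subdivision_power_diff Tdiff
                cochain_eval_diff sum_subtractf)
        have "cochain_coboundary p X b \<sigma> = cochain_eval b (chain_boundary (Suc p) (frag_of \<sigma>))"
          using True by (simp add: cochain_coboundary_def)
        also have "\<dots> = cochain_eval (\<lambda>\<tau>. - (\<Sum>i<M. cochain_eval z (T p (?sd p i (frag_of \<tau>)))))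
             (chain_boundary (Suc p) (frag_of \<sigma>))"
          by (rule cochain_eval_cong) (use b K mM in blast)
        also have "\<dots> = z \<sigma>"
          unfolding lin using telescope[of \<sigma> M] True N[of M] by (simp add: Suc M_def)
        finally show ?thesis .
      next
        case False
        then show ?thesis
          using z Suc by (auto simp: cochain_coboundary_def cocycles_def cochains_def)
      qed
    qed
    moreover have "b \<in> cochains p X"
      by (simp add: cochains_def b_def)
    ultimately show ?thesis
      unfolding Suc coboundaries_Suc_iff by (intro bexI[of _ b]) simp_all
  qed
qed

section \<open>Prism chains\<close>

abbreviation simplex_space :: "nat \<Rightarrow> (nat \<Rightarrow> real) topology" where
  "simplex_space n \<equiv> subtopology (powertop_real UNIV) (standard_simplex n)"

abbreviation simplex_cylinder :: "nat \<Rightarrow> (real \<times> (nat \<Rightarrow> real)) topology" where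
  "simplex_cylinder n \<equiv> prod_topology (top_of_set {0..1}) (simplex_space n)"

text \<open>
  The identity is homotopic to a constant map, so \<open>c\<close> is homologous to its image in a one-point
  space. In positive degree cycles of a point are boundaries; in degree \<open>0\<close> the image of a
  difference of two simplices is zero.
\<close>

lemma contractible_cycle_is_boundary:
  assumes S: "contractible_space S" and c: "singular_relcycle p S {} c"
    and 0: "p = 0 \<Longrightarrow> \<exists>s t. c = frag_of s - frag_of t"
  shows "\<exists>e. singular_chain (Suc p) S e \<and> chain_boundary (Suc p) e = c"
proof (cases "S = trivial_topology")
  case True
  then have "c = 0"
    using c by (auto simp: singular_cycle singular_chain_empty)
  then show ?thesis by (intro exI[of _ 0]) auto
next
  case False
  then obtain a where a: "a \<in> topspace S" and h: "homotopic_with (\<lambda>x. True) S S id (\<lambda>x. a)"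
    using S by (auto simp: contractible_space)
  have "homologous_rel p S {} (chain_map p id c) (chain_map p (\<lambda>x. a) c)"
    by (rule homotopic_imp_homologous_rel_chain_maps[where T="{}"]) (use h c in auto)
  moreover have "chain_map p id c = c"
    using c chain_map_ident singular_cycle by blast
  moreover have "singular_relboundary p S {} (chain_map p (\<lambda>x. a) c)"
  proof (cases "p = 0")
    case True
    then obtain s t where "c = frag_of s - frag_of t" using 0 by blast
    then have "chain_map p (\<lambda>x. a) c = 0"
      by (simp add: chain_map_diff simplex_map_def o_def)
    then show ?thesis by simp
  next
    case False
    have "singular_relcycle p (subtopology S {a}) {} (chain_map p (\<lambda>x. a) c)"
      by (rule singular_relcycle_chain_map[OF c]) (use a in auto)
    moreover have "topspace (subtopology S {a}) = {a}" using a by auto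
    ultimately have "singular_relboundary p (subtopology S {a}) {} (chain_map p (\<lambda>x. a) c)"
      using singular_boundary_eq_cycle_singleton[of "subtopology S {a}" a p] False by simp
    then show ?thesis
      using singular_boundary_mono[of "{a}" UNIV p S] by simp
  qed
  ultimately have "singular_relboundary p S {} c"
    by (metis diff_add_cancel homologous_rel_def singular_relboundary_add)
  then show ?thesis by (simp add: singular_boundary)
qed

lemma contractible_simplex_space: "contractible_space (simplex_space n)"
proof -
  define e :: "nat \<Rightarrow> real" where "e = (\<lambda>j. if j = 0 then 1 else 0)"
  have e: "e \<in> standard_simplex n" by (simp add: e_def)
  have "continuous_map (prod_topology (top_of_set {0..1}) (simplex_space n)) (powertop_real UNIV)
          (\<lambda>(t, x) i. (1 - t) * x i + t * e i)"
  proof -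
    have 1: "continuous_map (prod_topology (top_of_set {0..1}) (simplex_space n)) euclideanreal fst"
      using continuous_map_into_fulltopology[OF continuous_map_fst] by auto
    have 2: "continuous_map (prod_topology (top_of_set {0..1}) (simplex_space n)) euclideanreal (\<lambda>z. snd z i)" for i
      by (rule continuous_map_compose[unfolded o_def, OF continuous_map_snd])
         (auto intro!: continuous_map_from_subtopology continuous_map_product_projection)
    show ?thesis
      unfolding continuous_map_componentwise_UNIV case_prod_unfold
      by (intro allI continuous_intros 1 2)
  qed
  then have "continuous_map (prod_topology (top_of_set {0..1}) (simplex_space n)) (simplex_space n)
          (\<lambda>(t, x) i. (1 - t) * x i + t * e i)"
    using e convex_standard_simplex by (auto simp: continuous_map_in_subtopology)
  then show ?thesis
    unfolding contractible_space_def homotopic_with_def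
    by (intro exI[of _ e] exI[of _ "\<lambda>(t, x) i. (1 - t) * x i + t * e i"]) auto
qed

lemma contractible_simplex_cylinder: "contractible_space (simplex_cylinder n)"
proof -
  have "contractible {0..1::real}"
    by (rule convex_imp_contractible) (rule convex_real_interval)
  then have "contractible_space (top_of_set {0..1::real})"
    by (simp only: contractible_space_top_of_set)
  then show ?thesis
    using contractible_simplex_space contractible_space_prod_topology by blast
qed

text \<open>
  A chain \<open>x\<close> of \<open>I \<times> \<Delta>\<^sup>p\<close> induces a natural map from the \<open>p\<close>-chains of any space \<open>S\<close> to the
  \<open>(p+1)\<close>-chains of \<open>I \<times> S\<close>, sending a simplex \<open>m\<close> to the image of \<open>x\<close> under \<open>id \<times> m\<close>. Here \<open>S\<close>
  is a space of real sequences, such as a standard simplex.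
\<close>

definition cylinder_operator ::
  "nat \<Rightarrow> (real \<times> (nat \<Rightarrow> real)) chain \<Rightarrow> (nat \<Rightarrow> real) chain \<Rightarrow> (real \<times> (nat \<Rightarrow> real)) chain" where
  "cylinder_operator p x c = frag_extend (\<lambda>m. chain_map (Suc p) (map_prod id m) x) c"

abbreviation simplex_id :: "nat \<Rightarrow> (nat \<Rightarrow> real) \<Rightarrow> nat \<Rightarrow> real" where
  "simplex_id n \<equiv> restrict id (standard_simplex n)"

text \<open>
  \<open>x\<close> is a triangulation of \<open>I \<times> \<Delta>\<^sup>n\<close> as far as its boundary can tell: the boundary is top minus bottom
  minus the side walls, and the walls are copies of the chain \<open>w\<close> one dimension below. The walls
  are written as the cylinder over the boundary of the universal simplex, since then the equation
  for \<open>w\<close> turns the vanishing of \<open>\<partial>\<partial>x\<close> into that of \<open>\<partial>\<partial>\<close> on the universal simplex.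
\<close>

definition is_prism ::
  "nat \<Rightarrow> (real \<times> (nat \<Rightarrow> real)) chain \<Rightarrow> (real \<times> (nat \<Rightarrow> real)) chain \<Rightarrow> bool" where
  "is_prism n w x \<longleftrightarrow> singular_chain (Suc n) (simplex_cylinder n) x \<and>
     (n > 0 \<longrightarrow> singular_chain n (simplex_cylinder (n - 1)) w) \<and>
     chain_boundary (Suc n) x =
       chain_map n (Pair 1) (frag_of (simplex_id n)) - chain_map n (Pair 0) (frag_of (simplex_id n))
       - cylinder_operator (n - 1) w (chain_boundary n (frag_of (simplex_id n)))"

lemma singular_simplex_simplex_id: "singular_simplex n (simplex_space n) (simplex_id n)"
  by (simp add: singular_simplex_def)

lemma continuous_map_cylinder:
  assumes "singular_simplex p S m"
  shows "continuous_map (simplex_cylinder p) (prod_topology (top_of_set {0..1}) S) (map_prod id m)"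
  using assms unfolding singular_simplex_def map_prod_def id_def
  by (auto simp: continuous_map_prod_top)

lemma cylinder_operator_0 [simp]: "cylinder_operator p x 0 = 0"
  by (simp add: cylinder_operator_def)
lemma cylinder_operator_diff: "cylinder_operator p x (a - b) = cylinder_operator p x a - cylinder_operator p x b"
  by (simp add: cylinder_operator_def frag_extend_diff)

lemma singular_chain_cylinder_operator:
  assumes "singular_chain (Suc p) (simplex_cylinder p) x" "singular_chain p (simplex_space n) c"
  shows "singular_chain (Suc p) (simplex_cylinder n) (cylinder_operator p x c)"
  unfolding cylinder_operator_def
  by (rule singular_chain_extend)
     (use assms in \<open>auto simp: singular_chain_def[of p] intro: singular_chain_chain_map continuous_map_cylinder\<close>)

lemma cylinder_operator_chain_map:
  assumes "singular_chain (Suc p) (simplex_cylinder p) w" "singular_chain p S c"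
  shows "chain_map (Suc p) (map_prod id m) (cylinder_operator p w c) = cylinder_operator p w (chain_map p m c)"
  using assms(2) unfolding singular_chain_def
proof (induction c rule: frag_induction)
  case (one s)
  have "chain_map (Suc p) (map_prod id m) (chain_map (Suc p) (map_prod id s) w) =
        chain_map (Suc p) (map_prod id m \<circ> map_prod id s) w"
    by (simp add: chain_map_compose)
  also have "\<dots> = chain_map (Suc p) (map_prod id (simplex_map p m s)) w"
    by (rule chain_map_eq[OF assms(1)]) (auto simp: simplex_map_def)
  finally show ?case
    by (simp only: cylinder_operator_def frag_extend_of chain_map_of)
qed (auto simp: chain_map_diff cylinder_operator_diff)

text \<open>
  By naturality the boundary formula for \<open>x\<close> on the universal simplex passes to every simplex:
  the cylinder operator is a chain homotopy between the two end inclusions.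
\<close>

lemma chain_boundary_cylinder_operator:
  assumes x: "is_prism p w x" and c: "singular_chain p S c"
  shows "chain_boundary (Suc p) (cylinder_operator p x c) =
         chain_map p (Pair 1) c - chain_map p (Pair 0) c - cylinder_operator (p - 1) w (chain_boundary p c)"
  using c unfolding singular_chain_def
proof (induction c rule: frag_induction)
  case (one m)
  then have m: "singular_simplex p S m" by simp
  let ?\<iota> = "frag_of (simplex_id p)"
  have ch: "singular_chain p (simplex_space p) ?\<iota>"
    by (simp add: singular_chain_of singular_simplex_simplex_id)
  have ends: "chain_map p (map_prod id m) (chain_map p (Pair t) ?\<iota>) = chain_map p (Pair t) (frag_of m)" for t
  proof -
    have "chain_map p (map_prod id m) (chain_map p (Pair t) ?\<iota>) = chain_map p (Pair t) (chain_map p m ?\<iota>)"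
      by (simp add: simplex_map_def cong: restrict_cong)
    then show ?thesis
      by (simp only: singular_simplex_chain_map_id[OF m])
  qed
  have side: "chain_map p (map_prod id m) (cylinder_operator (p - 1) w (chain_boundary p ?\<iota>)) =
              cylinder_operator (p - 1) w (chain_boundary p (frag_of m))"
  proof (cases p)
    case 0
    then show ?thesis by (simp add: chain_boundary_def)
  next
    case (Suc r)
    have "chain_map p (map_prod id m) (cylinder_operator r w (chain_boundary p ?\<iota>)) =
          cylinder_operator r w (chain_map r m (chain_boundary p ?\<iota>))"
      unfolding Suc
      by (rule cylinder_operator_chain_map)
         (use x Suc singular_chain_boundary[OF ch] in \<open>auto simp: is_prism_def\<close>)
    also have "chain_map r m (chain_boundary p ?\<iota>) = chain_boundary p (chain_map p m ?\<iota>)"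
      using chain_boundary_chain_map[OF ch, of m] Suc by simp
    also have "chain_map p m ?\<iota> = frag_of m"
      by (rule singular_simplex_chain_map_id[OF m])
    finally show ?thesis
      by (simp only: Suc diff_Suc_1)
  qed
  have "chain_boundary (Suc p) (cylinder_operator p x (frag_of m)) =
        chain_map p (map_prod id m) (chain_boundary (Suc p) x)"
    using x chain_boundary_chain_map[of "Suc p" "simplex_cylinder p" x "map_prod id m"]
    by (simp add: cylinder_operator_def is_prism_def)
  also have "chain_boundary (Suc p) x =
      chain_map p (Pair 1) ?\<iota> - chain_map p (Pair 0) ?\<iota> - cylinder_operator (p - 1) w (chain_boundary p ?\<iota>)"
    using x by (simp add: is_prism_def)
  finally show ?case
    by (simp only: chain_map_diff ends side)
next
  case (diff a b)
  then show ?case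
    by (simp add: cylinder_operator_diff chain_boundary_diff chain_map_diff)
qed auto

lemma continuous_map_Pair_simplex_space:
  assumes "t \<in> {0..1}"
  shows "continuous_map S (prod_topology (top_of_set {0..1}) S) (Pair (t::real))"
  using assms by (auto simp: continuous_map_pairwise o_def)

text \<open>
  The prescribed boundary is a cycle, because the cylinder over a cycle has top minus bottom as its
  boundary. The cylinder \<open>I \<times> \<Delta>\<^sup>n\<^sup>+\<^sup>1\<close> is contractible, so the cycle bounds.
\<close>

lemma is_prism_step:
  assumes x: "is_prism n w x"
  shows "\<exists>y. is_prism (Suc n) x y"
proof -
  let ?n = "Suc n"
  let ?\<iota> = "frag_of (simplex_id ?n)"
  let ?c = "chain_boundary ?n ?\<iota>"
  let ?z = "chain_map ?n (Pair 1) ?\<iota> - chain_map ?n (Pair 0) ?\<iota> - cylinder_operator n x ?c"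
  have \<iota>: "singular_chain ?n (simplex_space ?n) ?\<iota>"
    by (simp add: singular_chain_of singular_simplex_simplex_id)
  have c: "singular_chain n (simplex_space ?n) ?c"
    using singular_chain_boundary[OF \<iota>] by simp
  have cc: "chain_boundary n ?c = 0"
    using chain_boundary_boundary[OF \<iota>] by simp
  have x': "singular_chain ?n (simplex_cylinder n) x"
    using x by (simp add: is_prism_def)
  have z: "singular_chain ?n (simplex_cylinder ?n) ?z"
    by (intro singular_chain_diff singular_chain_chain_map[OF \<iota>] continuous_map_Pair_simplex_space
        singular_chain_cylinder_operator[OF x' c]) auto
  have "chain_boundary ?n ?z = 0"
    by (simp only: chain_boundary_diff chain_boundary_cylinder_operator[OF x c] cc
        chain_boundary_chain_map[OF \<iota>] diff_Suc_Suc diff_zero cylinder_operator_0 diff_0_right diff_self)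
  then have "singular_relcycle ?n (simplex_cylinder ?n) {} ?z"
    using z by (simp add: singular_cycle)
  from contractible_cycle_is_boundary[OF contractible_simplex_cylinder this]
  obtain y where "singular_chain (Suc ?n) (simplex_cylinder ?n) y" "chain_boundary (Suc ?n) y = ?z"
    by auto
  then show ?thesis
    using x' by (auto simp: is_prism_def)
qed

lemma is_prism_start: "\<exists>y. is_prism 0 0 y"
proof -
  let ?\<iota> = "frag_of (simplex_id 0)"
  let ?z = "chain_map 0 (Pair 1) ?\<iota> - chain_map 0 (Pair 0) ?\<iota>"
  have \<iota>: "singular_chain 0 (simplex_space 0) ?\<iota>"
    by (simp add: singular_chain_of singular_simplex_simplex_id)
  have z: "singular_chain 0 (simplex_cylinder 0) ?z"
    by (intro singular_chain_diff singular_chain_chain_map[OF \<iota>] continuous_map_Pair_simplex_space) auto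
  then have "singular_relcycle 0 (simplex_cylinder 0) {} ?z"
    by (simp add: singular_cycle chain_boundary_def)
  from contractible_cycle_is_boundary[OF contractible_simplex_cylinder this]
  obtain y where "singular_chain (Suc 0) (simplex_cylinder 0) y" "chain_boundary (Suc 0) y = ?z"
    by auto
  then show ?thesis
    by (auto simp: is_prism_def chain_boundary_def)
qed

text \<open>
  Prism chains by the method of acyclic models: they are chosen by recursion on the dimension
  instead of written down as sums of affine simplices. The walls over the faces are the
  same chain \<open>Q (n - 1)\<close> for all faces. A family of homotopies on simplices that is compatible with
  faces therefore maps the chains \<open>Q n\<close> to a chain homotopy.
\<close>

lemma prism_chains:
  obtains Q where "\<And>n. singular_chain (Suc n) (simplex_cylinder n) (Q n)"
    and "\<And>n. chain_boundary (Suc n) (Q n) =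
       chain_map n (Pair 1) (frag_of (simplex_id n)) - chain_map n (Pair 0) (frag_of (simplex_id n))
       - (if n = 0 then 0 else
          \<Sum>k\<le>n. frag_cmul ((-1) ^ k) (chain_map n (map_prod id (simplical_face k)) (Q (n - 1))))"
proof -
  obtain Q where Q: "\<And>n. \<exists>w. is_prism n w (Q n)" "\<And>n. is_prism (Suc n) (Q n) (Q (Suc n))"
    using dependent_nat_choice[of "\<lambda>n x. \<exists>w. is_prism n w x" "\<lambda>n x y. is_prism (Suc n) x y"]
      is_prism_start is_prism_step by metis
  have 1: "singular_chain (Suc n) (simplex_cylinder n) (Q n)" for n
    using Q(1)[of n] by (auto simp: is_prism_def)
  have 2: "chain_boundary (Suc n) (Q n) =
       chain_map n (Pair 1) (frag_of (simplex_id n)) - chain_map n (Pair 0) (frag_of (simplex_id n))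
       - (if n = 0 then 0 else
          \<Sum>k\<le>n. frag_cmul ((-1) ^ k) (chain_map n (map_prod id (simplical_face k)) (Q (n - 1))))" for n
  proof (cases n)
    case 0
    then show ?thesis
      using Q(1)[of 0] by (auto simp: is_prism_def chain_boundary_def)
  next
    case (Suc p)
    have "chain_map n (map_prod id (singular_face n k (simplex_id n))) (Q p) =
          chain_map n (map_prod id (simplical_face k)) (Q p)" if "k \<le> n" for k
      unfolding Suc
      by (rule chain_map_eq[OF 1])
         (use that Suc simplical_face_in_standard_simplex[of "Suc p" k] in \<open>auto simp: singular_face_def\<close>)
    then have "cylinder_operator p (Q p) (chain_boundary n (frag_of (simplex_id n))) =
       (\<Sum>k\<le>n. frag_cmul ((-1) ^ k) (chain_map n (map_prod id (simplical_face k)) (Q p)))"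
      using Suc by (simp add: cylinder_operator_def chain_boundary_of frag_extend_sum frag_extend_cmul
          del: sum.atMost_Suc singular_face_restrict)
    then show ?thesis
      using Q(2)[of p] Suc by (simp add: is_prism_def del: sum.atMost_Suc)
  qed
  show thesis by (rule that[OF 1 2])
qed

section \<open>The disc as a simplex\<close>

definition open_simplex :: "nat \<Rightarrow> (nat \<Rightarrow> real) set" where
  "open_simplex n = {x \<in> standard_simplex n. \<forall>i\<le>n. 0 < x i}"

text \<open>
  The linear isomorphism from \<open>\<real>\<^sup>n\<close> to the space of vectors with \<open>n+1\<close> coordinates of sum zero, which
  are the differences of points of the affine hull of the simplex.
\<close>

definition sum_zero_lift :: "nat \<Rightarrow> (nat \<Rightarrow> real) \<Rightarrow> nat \<Rightarrow> real" where
  "sum_zero_lift n x = (\<lambda>i. if i < n then x i else if i = n then - (\<Sum>j<n. x j) else 0)"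

definition disc_norm :: "nat \<Rightarrow> (nat \<Rightarrow> real) \<Rightarrow> real" where
  "disc_norm n x = sqrt (\<Sum>i<n. (x i)\<^sup>2)"

text \<open>
  The Minkowski gauge of the simplex with its barycentre moved to the origin: the barycentric
  coordinates \<open>1/(n+1) + y\<^sub>i\<close> are all nonnegative iff \<open>(n+1) max\<^sub>i (-y\<^sub>i) \<le> 1\<close>.
\<close>

definition simplex_gauge :: "nat \<Rightarrow> (nat \<Rightarrow> real) \<Rightarrow> real" where
  "simplex_gauge n x = real (n + 1) * (MAX i\<in>{..n}. - sum_zero_lift n x i)"

text \<open>
  The radial homeomorphism from the disc to the simplex: it preserves rays and carries the norm to
  the gauge. At the centre the quotient is \<open>0/0 = 0\<close>, so the centre goes to the barycentre.
\<close>

definition disc_to_simplex :: "nat \<Rightarrow> (nat \<Rightarrow> real) \<Rightarrow> nat \<Rightarrow> real" where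
  "disc_to_simplex n x = (\<lambda>i. if i \<le> n
     then 1 / real (n + 1) + disc_norm n x / simplex_gauge n x * sum_zero_lift n x i else 0)"

lemma sum_sum_zero_lift: "(\<Sum>i\<le>n. sum_zero_lift n x i) = 0"
proof -
  have "(\<Sum>i\<le>n. sum_zero_lift n x i) = (\<Sum>i<n. sum_zero_lift n x i) + sum_zero_lift n x n"
    by (simp flip: lessThan_Suc_atMost)
  also have "(\<Sum>i<n. sum_zero_lift n x i) = (\<Sum>i<n. x i)"
    by (rule sum.cong) (auto simp: sum_zero_lift_def)
  finally show ?thesis by (simp add: sum_zero_lift_def)
qed

lemma gauge_ge: "i \<le> n \<Longrightarrow> - (real (n + 1) * sum_zero_lift n x i) \<le> simplex_gauge n x"
proof -
  assume "i \<le> n"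
  then have "- sum_zero_lift n x i \<le> (MAX i\<in>{..n}. - sum_zero_lift n x i)"
    by (intro Max_ge) auto
  from mult_left_mono[OF this, of "real (n + 1)"] show ?thesis
    by (simp add: simplex_gauge_def)
qed

lemma gauge_attained: "\<exists>i\<le>n. simplex_gauge n x = - (real (n + 1) * sum_zero_lift n x i)"
proof -
  have "(MAX i\<in>{..n}. - sum_zero_lift n x i) \<in> (\<lambda>i. - sum_zero_lift n x i) ` {..n}"
    by (rule Max_in) auto
  then obtain i where "(MAX i\<in>{..n}. - sum_zero_lift n x i) = - sum_zero_lift n x i" "i \<in> {..n}"
    by (rule imageE)
  then show ?thesis
    by (intro exI[of _ i]) (simp add: simplex_gauge_def)
qed

text \<open>
  As the coordinates sum to zero, a positive one is at most \<open>n\<close> times the largest negative part. This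
  makes the gauge positive away from the origin and gives continuity of the radial map
  at the centre.
\<close>

lemma abs_lift_le_gauge:
  assumes "i \<le> n"
  shows "\<bar>sum_zero_lift n x i\<bar> \<le> simplex_gauge n x"
proof -
  let ?y = "sum_zero_lift n x" and ?G = "simplex_gauge n x"
  have le: "- ?y j \<le> ?G / real (n + 1)" if "j \<le> n" for j
    using gauge_ge[OF that, of x] by (simp add: field_simps)
  have "?y i = (\<Sum>j\<in>{..n} - {i}. - ?y j)"
    using sum_sum_zero_lift[of n x] assms by (simp add: sum_diff1 sum_negf)
  also have "\<dots> \<le> (\<Sum>j\<in>{..n} - {i}. ?G / real (n + 1))"
    by (rule sum_mono) (use le in auto)
  also have "\<dots> = real n * (?G / real (n + 1))"
    using assms by simp
  finally have up: "?y i \<le> real n * (?G / real (n + 1))" .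
  have G0: "0 \<le> ?G"
  proof -
    have "(\<Sum>j\<le>n. - ?y j) \<le> (\<Sum>j\<le>n. ?G / real (n + 1))"
      by (rule sum_mono) (use le in auto)
    then show ?thesis
      using sum_sum_zero_lift[of n x] by (simp add: sum_negf)
  qed
  have "real n * (?G / real (n + 1)) \<le> ?G" "?G / real (n + 1) \<le> ?G"
    using G0 by (auto simp: field_simps mult_left_mono)
  with up le[OF assms] show ?thesis by linarith
qed

lemma gauge_nonneg: "0 \<le> simplex_gauge n x"
  using abs_lift_le_gauge[of 0 n x] by simp

lemma gauge_eq_0_iff: "simplex_gauge n x = 0 \<longleftrightarrow> (\<forall>i<n. x i = 0)"
proof
  assume "simplex_gauge n x = 0"
  then have "\<bar>sum_zero_lift n x i\<bar> \<le> 0" if "i < n" for i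
    using abs_lift_le_gauge[of i n x] that by simp
  then show "\<forall>i<n. x i = 0"
    by (auto simp: sum_zero_lift_def)
next
  assume "\<forall>i<n. x i = 0"
  then have "sum_zero_lift n x i = 0" for i
    by (simp add: sum_zero_lift_def)
  then show "simplex_gauge n x = 0"
    by (simp add: simplex_gauge_def)
qed

lemma disc_norm_eq_0_iff: "disc_norm n x = 0 \<longleftrightarrow> (\<forall>i<n. x i = 0)"
  by (auto simp: disc_norm_def sum_nonneg_eq_0_iff)

lemma disc_norm_nonneg: "0 \<le> disc_norm n x"
  by (simp add: disc_norm_def sum_nonneg)

lemma lift_scale: "sum_zero_lift n (\<lambda>i. c * x i) = (\<lambda>i. c * sum_zero_lift n x i)"
  by (auto simp: sum_zero_lift_def sum_distrib_left)

lemma gauge_scale: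
  assumes "0 \<le> c" shows "simplex_gauge n (\<lambda>i. c * x i) = c * simplex_gauge n x"
proof -
  obtain i where i: "i \<le> n" "simplex_gauge n x = - (real (n + 1) * sum_zero_lift n x i)"
    using gauge_attained by blast
  obtain j where j: "j \<le> n" "simplex_gauge n (\<lambda>i. c * x i) = - (real (n + 1) * (c * sum_zero_lift n x j))"
    using gauge_attained[of n "\<lambda>i. c * x i"] by (auto simp: lift_scale)
  have "simplex_gauge n (\<lambda>i. c * x i) \<ge> c * simplex_gauge n x"
    using gauge_ge[OF i(1), of "\<lambda>i. c * x i"] i(2) by (simp add: lift_scale mult_ac)
  moreover have "simplex_gauge n (\<lambda>i. c * x i) \<le> c * simplex_gauge n x"
    using mult_left_mono[OF gauge_ge[OF j(1), of x] assms] j(2) by (simp add: mult_ac)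
  ultimately show ?thesis by simp
qed

lemma disc_norm_scale: "0 \<le> c \<Longrightarrow> disc_norm n (\<lambda>i. c * x i) = c * disc_norm n x"
  by (simp add: disc_norm_def power_mult_distrib real_sqrt_mult flip: sum_distrib_left)

text \<open>
  The least barycentric coordinate of the image of \<open>x\<close> is \<open>(1 - |x|)/(n+1)\<close>. So it is nonnegative on
  the disc, and positive exactly inside.
\<close>

lemma disc_to_simplex_in:
  assumes "disc_norm n x \<le> 1"
  shows "disc_to_simplex n x \<in> standard_simplex n"
    and "disc_to_simplex n x \<in> open_simplex n \<longleftrightarrow> disc_norm n x < 1"
proof -
  let ?t = "disc_to_simplex n x" and ?G = "simplex_gauge n x" and ?N = "disc_norm n x"
  have sum1: "(\<Sum>i\<le>n. ?t i) = 1"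
  proof -
    have "(\<Sum>i\<le>n. ?t i) = (\<Sum>i\<le>n. 1 / real (n + 1) + ?N / ?G * sum_zero_lift n x i)"
      by (rule sum.cong) (auto simp: disc_to_simplex_def)
    also have "\<dots> = 1"
      unfolding sum.distrib sum_distrib_left[symmetric] sum_sum_zero_lift by simp
    finally show ?thesis .
  qed
  have scaled: "real (n + 1) * ?t i = 1 + ?N / ?G * (real (n + 1) * sum_zero_lift n x i)" if "i \<le> n" for i
  proof -
    have "c * (1 / c + a * b) = 1 + a * (c * b)" if "c \<noteq> 0" for a b c :: real
      using that by (simp add: distrib_left)
    from this[of "real (n + 1)" "?N / ?G" "sum_zero_lift n x i"] show ?thesis
      using that by (simp only: disc_to_simplex_def if_True)
  qed
  have key: "real (n + 1) * ?t i \<ge> 1 - ?N" if "i \<le> n" for i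
  proof (cases "?G = 0")
    case True
    then show ?thesis using that disc_norm_nonneg[of n x] by (simp add: disc_to_simplex_def)
  next
    case False
    then have "?N / ?G * - (real (n + 1) * sum_zero_lift n x i) \<le> ?N / ?G * ?G"
      by (intro mult_left_mono gauge_ge[OF that]) (simp add: disc_norm_nonneg gauge_nonneg)
    moreover note scaled[OF that]
    ultimately show ?thesis
      using False by simp
  qed
  have attained: "\<exists>i\<le>n. real (n + 1) * ?t i = 1 - ?N"
  proof (cases "?G = 0")
    case True
    then have "?N = 0" by (simp add: gauge_eq_0_iff disc_norm_eq_0_iff)
    then show ?thesis by (auto simp: disc_to_simplex_def)
  next
    case False
    obtain i where i: "i \<le> n" "?G = - (real (n + 1) * sum_zero_lift n x i)"
      using gauge_attained by blast
    have "real (n + 1) * ?t i = 1 - ?N / ?G * (- (real (n + 1) * sum_zero_lift n x i))"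
      using scaled[OF i(1)] by simp
    also have "\<dots> = 1 - ?N" unfolding i(2)[symmetric] using False by simp
    finally show ?thesis using i(1) by blast
  qed
  have nn: "0 \<le> ?t i" for i
  proof (cases "i \<le> n")
    case True
    from key[OF True] assms have "0 \<le> real (n + 1) * ?t i" by linarith
    then show ?thesis by (simp add: zero_le_mult_iff)
  qed (simp add: disc_to_simplex_def)
  have "?t i \<le> 1" for i
  proof (cases "i \<le> n")
    case True
    then have "?t i \<le> (\<Sum>i\<le>n. ?t i)" by (intro member_le_sum) (use nn in auto)
    then show ?thesis using sum1 by simp
  qed (simp add: disc_to_simplex_def)
  with nn sum1 show *: "?t \<in> standard_simplex n"
    by (auto simp: standard_simplex_def disc_to_simplex_def)
  show "?t \<in> open_simplex n \<longleftrightarrow> ?N < 1"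
  proof
    assume "?t \<in> open_simplex n"
    then show "?N < 1" using attained by (auto simp: open_simplex_def) (smt (verit) mult_pos_pos of_nat_0_less_iff zero_less_Suc of_nat_Suc)
  next
    assume N: "?N < 1"
    have "0 < ?t i" if "i \<le> n" for i
    proof -
      from key[OF that] N have "0 < real (n + 1) * ?t i" by linarith
      then show ?thesis by (simp add: zero_less_mult_iff)
    qed
    then show "?t \<in> open_simplex n" using * by (simp add: open_simplex_def)
  qed
qed

text \<open>
  Equal images mean equal positive multiples of \<open>x\<close> and \<open>y\<close>. Comparing gauges gives \<open>|x| = |y|\<close>, and
  comparing norms then shows that the two factors are equal.
\<close>

lemma disc_to_simplex_inj:
  assumes eq: "disc_to_simplex n x = disc_to_simplex n y" and "\<forall>i\<ge>n. x i = 0" "\<forall>i\<ge>n. y i = 0"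
  shows "x = y"
proof -
  define a b where "a = disc_norm n x / simplex_gauge n x" and "b = disc_norm n y / simplex_gauge n y"
  have a0: "0 \<le> a" "0 \<le> b" by (simp_all add: a_def b_def disc_norm_nonneg gauge_nonneg)
  have xy: "(\<lambda>i. a * x i) = (\<lambda>i. b * y i)"
  proof
    fix i
    show "a * x i = b * y i"
    proof (cases "i < n")
      case True
      then show ?thesis
        using fun_cong[OF eq, of i] by (simp add: disc_to_simplex_def a_def b_def sum_zero_lift_def)
    qed (use assms in auto)
  qed
  have N: "a * simplex_gauge n x = disc_norm n x" "b * simplex_gauge n y = disc_norm n y"
    unfolding a_def b_def using gauge_eq_0_iff[of n] disc_norm_eq_0_iff[of n] by (auto simp: field_simps)
  have Neq: "disc_norm n x = disc_norm n y"
    using gauge_scale[OF a0(1), of n x] gauge_scale[OF a0(2), of n y] xy N by simp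
  show ?thesis
  proof (cases "disc_norm n x = 0")
    case True
    moreover from this have "disc_norm n y = 0"
      using Neq by simp
    ultimately have "x i = y i" for i
      using assms(2,3) by (cases "i < n") (auto simp: disc_norm_eq_0_iff)
    then show ?thesis by auto
  next
    case False
    have "a * disc_norm n x = b * disc_norm n y"
      using disc_norm_scale[OF a0(1), of n x] disc_norm_scale[OF a0(2), of n y] xy by simp
    with Neq False have "a = b" by simp
    moreover have "a \<noteq> 0" using N False by auto
    ultimately show ?thesis using xy by (auto simp: fun_eq_iff)
  qed
qed

lemma disc_to_simplex_surj:
  assumes t: "t \<in> standard_simplex n"
  obtains x where "\<forall>i\<ge>n. x i = 0" "disc_norm n x \<le> 1" "disc_to_simplex n x = t"
proof -
  define y where "y = (\<lambda>i. if i < n then t i - 1 / real (n + 1) else 0)"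
  have sum1: "(\<Sum>i\<le>n. t i) = 1" and t0: "\<And>i. i > n \<Longrightarrow> t i = 0" "\<And>i. 0 \<le> t i"
    using t by (auto simp: standard_simplex_def)
  have lift: "sum_zero_lift n y i = t i - 1 / real (n + 1)" if "i \<le> n" for i
  proof (cases "i < n")
    case False
    then have i: "i = n" using that by simp
    have "(\<Sum>j<n. y j) = (\<Sum>j<n. t j) - real n / real (n + 1)"
      by (simp add: y_def sum_subtractf)
    moreover have "(\<Sum>j<n. t j) = 1 - t n"
      using sum1 by (simp flip: lessThan_Suc_atMost)
    ultimately show ?thesis by (simp add: i sum_zero_lift_def field_simps)
  qed (simp add: sum_zero_lift_def y_def)
  have G: "simplex_gauge n y \<le> 1"
  proof -
    obtain i where "i \<le> n" "simplex_gauge n y = - (real (n + 1) * sum_zero_lift n y i)"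
      using gauge_attained by blast
    then have "simplex_gauge n y = 1 - real (n + 1) * t i"
      using lift[of i] by (simp add: right_diff_distrib)
    then show ?thesis using t0(2)[of i] by simp
  qed
  \<comment> \<open>The inverse map: the gauge of a point becomes its norm.\<close>
  define c where "c = simplex_gauge n y / disc_norm n y"
  define x where "x = (\<lambda>i. c * y i)"
  have c0: "0 \<le> c" by (simp add: c_def disc_norm_nonneg gauge_nonneg)
  have cN: "c * disc_norm n y = simplex_gauge n y"
    unfolding c_def using gauge_eq_0_iff[of n y] disc_norm_eq_0_iff[of n y] by auto
  have N: "disc_norm n x = simplex_gauge n y"
    by (simp add: x_def disc_norm_scale[OF c0] cN)
  have "disc_to_simplex n x i = t i" for i
  proof (cases "i \<le> n")
    case True
    have "disc_norm n x / simplex_gauge n x * sum_zero_lift n x i = sum_zero_lift n y i"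
    proof (cases "simplex_gauge n y = 0")
      case True
      then have "sum_zero_lift n y i = 0"
        using abs_lift_le_gauge[OF \<open>i \<le> n\<close>, of y] by simp
      then show ?thesis by (simp add: x_def lift_scale)
    next
      case False
      then have "c \<noteq> 0" using cN by auto
      then show ?thesis
        using False by (simp add: N) (simp add: x_def lift_scale gauge_scale[OF c0])
    qed
    then show ?thesis using True by (simp add: disc_to_simplex_def lift)
  qed (simp add: disc_to_simplex_def t0)
  then show thesis
    by (intro that[of x]) (use N G in \<open>auto simp: x_def y_def\<close>)
qed

lemma continuous_on_Max_image:
  fixes f :: "'i \<Rightarrow> 'x::topological_space \<Rightarrow> real"
  assumes "finite A" "A \<noteq> {}" "\<And>i. i \<in> A \<Longrightarrow> continuous_on S (f i)"
  shows "continuous_on S (\<lambda>x. MAX i\<in>A. f i x)"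
  using assms
proof (induction A rule: finite_ne_induct)
  case (insert i A)
  then have "(\<lambda>x. MAX i\<in>insert i A. f i x) = (\<lambda>x. max (f i x) (MAX i\<in>A. f i x))"
    by simp
  then show ?case
    using insert by (auto intro!: continuous_on_max)
qed simp

lemma continuous_on_coordinate: "continuous_on S (\<lambda>x :: nat \<Rightarrow> real. x i)"
  by (rule continuous_on_subset[OF continuous_on_product_coordinates subset_UNIV])

lemma continuous_on_sum_zero_lift: "continuous_on S (\<lambda>x. sum_zero_lift n x i)"
  by (cases "i < n"; cases "i = n")
     (auto simp: sum_zero_lift_def intro!: continuous_intros continuous_on_coordinate)

lemma continuous_on_gauge: "continuous_on S (simplex_gauge n)"
  unfolding simplex_gauge_def
  by (intro continuous_on_mult continuous_on_const continuous_on_Max_image continuous_on_minus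
      continuous_on_sum_zero_lift) auto

lemma continuous_on_disc_norm: "continuous_on S (disc_norm n)"
  unfolding disc_norm_def
  by (intro continuous_intros continuous_on_coordinate)

text \<open>
  Away from the origin this is a quotient of continuous functions. At the origin the quotient is
  discontinuous in general, but the product is bounded by the norm.
\<close>

lemma continuous_on_radial:
  assumes "i \<le> n"
  shows "continuous_on S (\<lambda>x. disc_norm n x / simplex_gauge n x * sum_zero_lift n x i)" (is "continuous_on S ?F")
  unfolding continuous_on_eq_continuous_within
proof
  fix x assume x: "x \<in> S"
  have N: "continuous (at x within S) (disc_norm n)"
    using continuous_on_disc_norm x continuous_on_eq_continuous_within by blast
  show "continuous (at x within S) ?F"
  proof (cases "simplex_gauge n x = 0")
    case False
    have "continuous (at x within S) (simplex_gauge n)" 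
      "continuous (at x within S) (\<lambda>x. sum_zero_lift n x i)"
      using continuous_on_gauge continuous_on_sum_zero_lift x continuous_on_eq_continuous_within by blast+
    with N False show ?thesis
      unfolding continuous_within by (intro tendsto_mult tendsto_divide)
  next
    case True
    then have N0: "disc_norm n x = 0" by (simp add: gauge_eq_0_iff disc_norm_eq_0_iff)
    have bound: "norm (?F z) \<le> disc_norm n z" for z
    proof (cases "simplex_gauge n z = 0")
      case False
      have "norm (?F z) = disc_norm n z / simplex_gauge n z * \<bar>sum_zero_lift n z i\<bar>"
        by (simp add: abs_mult disc_norm_nonneg gauge_nonneg)
      also have "\<dots> \<le> disc_norm n z / simplex_gauge n z * simplex_gauge n z"
        by (intro mult_left_mono abs_lift_le_gauge assms) (simp add: disc_norm_nonneg gauge_nonneg)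
      finally show ?thesis using False by simp
    qed (simp add: disc_norm_nonneg)
    have "(disc_norm n \<longlongrightarrow> 0) (at x within S)"
      using N N0 by (simp add: continuous_within)
    then have "(?F \<longlongrightarrow> 0) (at x within S)"
      by (rule Lim_null_comparison[rotated]) (intro always_eventually allI bound)
    then show ?thesis
      using N0 by (simp add: continuous_within)
  qed
qed

lemma continuous_map_disc_to_simplex:
  "continuous_map (subtopology (Euclidean_space n) (unit_disc n))
     (subtopology (powertop_real UNIV) (standard_simplex n)) (disc_to_simplex n)"
proof -
  let ?D = "unit_disc n"
  have top: "subtopology (Euclidean_space n) ?D = top_of_set ?D"
    by (auto simp: Euclidean_space_def subtopology_subtopology unit_disc_def euclidean_product_topology
        intro!: arg_cong2[of _ _ _ _ subtopology])
  have "continuous_on ?D (\<lambda>x. disc_to_simplex n x i)" for i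
    by (cases "i \<le> n") (auto simp: disc_to_simplex_def intro!: continuous_intros continuous_on_radial
        simp del: times_divide_eq_left)
  then have "continuous_map (subtopology (Euclidean_space n) ?D) (powertop_real UNIV) (disc_to_simplex n)"
    unfolding top continuous_map_componentwise_UNIV by simp
  moreover have "disc_to_simplex n x \<in> standard_simplex n" if "x \<in> ?D" for x
    by (rule disc_to_simplex_in) (use that in \<open>auto simp: unit_disc_def disc_norm_def\<close>)
  ultimately show ?thesis
    by (auto simp: continuous_map_in_subtopology)
qed

lemma disc_norm_le: "disc_norm n x \<le> 1 \<longleftrightarrow> (\<Sum>i<n. (x i)\<^sup>2) \<le> 1"
  and disc_norm_less: "disc_norm n x < 1 \<longleftrightarrow> (\<Sum>i<n. (x i)\<^sup>2) < 1"
  by (simp_all add: disc_norm_def)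

lemma disc_to_simplex_image_disc: "disc_to_simplex n ` unit_disc n = standard_simplex n"
proof
  show "disc_to_simplex n ` unit_disc n \<subseteq> standard_simplex n"
    using disc_to_simplex_in(1)[of n] by (auto simp: unit_disc_def disc_norm_le)
  show "standard_simplex n \<subseteq> disc_to_simplex n ` unit_disc n"
  proof
    fix t assume "t \<in> standard_simplex n"
    then obtain x where "\<forall>i\<ge>n. x i = 0" "disc_norm n x \<le> 1" "disc_to_simplex n x = t"
      by (rule disc_to_simplex_surj)
    then show "t \<in> disc_to_simplex n ` unit_disc n"
      by (intro image_eqI[of _ _ x]) (auto simp: unit_disc_def topspace_Euclidean_space disc_norm_le)
  qed
qed

lemma disc_to_simplex_in_open_simplex_iff:
  "x \<in> unit_disc n \<Longrightarrow> disc_to_simplex n x \<in> open_simplex n \<longleftrightarrow> x \<in> open_unit_disc n"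
  using disc_to_simplex_in(2)[of n x] by (auto simp: unit_disc_def open_unit_disc_def disc_norm_le disc_norm_less)

lemma disc_to_simplex_image_open_disc: "disc_to_simplex n ` open_unit_disc n = open_simplex n"
proof -
  have "open_unit_disc n = {x \<in> unit_disc n. disc_to_simplex n x \<in> open_simplex n}"
    using disc_to_simplex_in_open_simplex_iff[of _ n] by (auto simp: unit_disc_def open_unit_disc_def)
  then have "disc_to_simplex n ` open_unit_disc n = disc_to_simplex n ` unit_disc n \<inter> open_simplex n"
    by auto
  then show ?thesis by (auto simp: disc_to_simplex_image_disc open_simplex_def)
qed

lemma inj_on_disc_to_simplex: "inj_on (disc_to_simplex n) (unit_disc n)"
  by (auto simp: inj_on_def unit_disc_def topspace_Euclidean_space intro: disc_to_simplex_inj)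

lemma compact_space_unit_disc: "compact_space (subtopology (Euclidean_space n) (unit_disc n))"
proof -
  let ?B = "PiE UNIV (\<lambda>i::nat. if i < n then {-1..1} else {0::real})"
  have "unit_disc n = ?B \<inter> {x \<in> topspace (powertop_real UNIV). (\<Sum>i<n. (x i)\<^sup>2) \<in> {..1}}"
  proof -
    have "\<bar>x i\<bar> \<le> 1" if "(\<Sum>i<n. (x i)\<^sup>2) \<le> 1" "i < n" for x :: "nat \<Rightarrow> real" and i
    proof -
      have "(x i)\<^sup>2 \<le> (\<Sum>i<n. (x i)\<^sup>2)" by (intro member_le_sum) (use that in auto)
      then have "(x i)\<^sup>2 \<le> 1" using that by linarith
      then show ?thesis by (simp add: abs_square_le_1)
    qed
    then show ?thesis
      by (fastforce simp: unit_disc_def topspace_Euclidean_space PiE_iff abs_le_iff not_less)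
  qed
  moreover have "compactin (powertop_real UNIV) ?B"
    by (auto simp: compactin_PiE)
  moreover have "closedin (powertop_real UNIV) {x \<in> topspace (powertop_real UNIV). (\<Sum>i<n. (x i)\<^sup>2) \<in> {..1}}"
  proof (rule closedin_continuous_map_preimage)
    show "continuous_map (powertop_real UNIV) euclideanreal (\<lambda>x. \<Sum>i<n. (x i)\<^sup>2)"
      by (intro continuous_map_sum continuous_map_real_pow continuous_map_product_projection) auto
  qed auto
  ultimately have "compactin (powertop_real UNIV) (unit_disc n)"
    by (simp add: closed_Int_compactin compact_Int_closedin)
  moreover have "subtopology (Euclidean_space n) (unit_disc n) = subtopology (powertop_real UNIV) (unit_disc n)"
    by (auto simp: Euclidean_space_def subtopology_subtopology unit_disc_def
        intro!: arg_cong2[of _ _ _ _ subtopology])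
  ultimately show ?thesis
    by (simp add: compact_space_subtopology)
qed

section \<open>Faces spanned by sets of vertices\<close>

text \<open>
  A set \<open>S\<close> of vertices spans a face of a simplex. The monotone numbering of its vertices is
  the rank within \<open>S\<close>, and with it the face is itself parametrised by a standard simplex.
\<close>

definition rank_in :: "nat set \<Rightarrow> nat \<Rightarrow> nat" where
  "rank_in S i = card {l \<in> S. l < i}"

definition face_inclusion :: "nat set \<Rightarrow> (nat \<Rightarrow> real) \<Rightarrow> nat \<Rightarrow> real" where
  "face_inclusion S y = (\<lambda>i. if i \<in> S then y (rank_in S i) else 0)"

text \<open>
  The left inverse of the inclusion of the face \<open>S\<close>. The sum has one summand if \<open>k\<close> is
  the rank of an element of \<open>S\<close> and is empty otherwise; the form as a sum makes continuity and
  reindexing immediate.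
\<close>

definition face_coordinates :: "nat set \<Rightarrow> (nat \<Rightarrow> real) \<Rightarrow> nat \<Rightarrow> real" where
  "face_coordinates S x = (\<lambda>k. \<Sum>i | i \<in> S \<and> rank_in S i = k. x i)"

definition support :: "(nat \<Rightarrow> real) \<Rightarrow> nat set" where
  "support x = {i. x i \<noteq> 0}"

definition face_on :: "nat set \<Rightarrow> ((nat \<Rightarrow> real) \<Rightarrow> 'a) \<Rightarrow> (nat \<Rightarrow> real) \<Rightarrow> 'a" where
  "face_on S \<sigma> = restrict (\<sigma> \<circ> face_inclusion S) (standard_simplex (card S - 1))"

text \<open>
  The characteristic map of the simplex \<open>\<sigma>\<close> in the fat realisation. A point of the realisation is
  represented by the unique pair whose second component is interior to its simplex, so \<open>(\<sigma>, x)\<close> is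
  replaced by the face of \<open>\<sigma>\<close> spanned by the support of \<open>x\<close>. Degenerate simplices are not
  collapsed.
\<close>

definition simplex_point :: "((nat \<Rightarrow> real) \<Rightarrow> 'a) \<Rightarrow> (nat \<Rightarrow> real) \<Rightarrow> 'a realisation_point" where
  "simplex_point \<sigma> x = (face_on (support x) \<sigma>, face_coordinates (support x) x)"

lemma rank_in_less_card: "\<lbrakk>finite S; i \<in> S\<rbrakk> \<Longrightarrow> rank_in S i < card S"
  unfolding rank_in_def by (rule psubset_card_mono) auto

lemma strict_mono_on_rank_in:
  assumes "finite S" shows "strict_mono_on S (rank_in S)"
proof (rule strict_mono_onI)
  fix i j assume "i \<in> S" "j \<in> S" "i < j"
  with assms show "rank_in S i < rank_in S j"
    unfolding rank_in_def by (intro psubset_card_mono) auto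
qed

lemma inj_on_rank_in: "finite S \<Longrightarrow> inj_on (rank_in S) S"
  using strict_mono_on_imp_inj_on strict_mono_on_rank_in by blast

lemma image_rank_in:
  assumes "finite S" shows "rank_in S ` S = {..<card S}"
  by (rule card_subset_eq) (use assms in \<open>auto simp: rank_in_less_card card_image inj_on_rank_in\<close>)

lemma rank_in_image:
  assumes f: "strict_mono_on I f" and i: "i \<in> I"
  shows "rank_in (f ` I) (f i) = rank_in I i"
proof -
  have "{l \<in> f ` I. l < f i} = f ` {l \<in> I. l < i}"
    using strict_mono_on_less[OF f] i by auto
  moreover have "inj_on f {l \<in> I. l < i}"
    using strict_mono_on_imp_inj_on[OF f] by (rule inj_on_subset) auto
  ultimately show ?thesis
    by (simp add: rank_in_def card_image)
qed

lemma rank_in_atMost: "i \<le> n \<Longrightarrow> rank_in {..n} i = i"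
proof -
  assume "i \<le> n"
  then have "{l \<in> {..n}. l < i} = {..<i}" by auto
  then show ?thesis by (simp add: rank_in_def)
qed

lemma face_coordinates_image:
  assumes f: "strict_mono_on I f" and "\<And>i. i \<in> I \<Longrightarrow> y (f i) = x i"
  shows "face_coordinates (f ` I) y = face_coordinates I x"
proof
  fix k
  have "{j. j \<in> f ` I \<and> rank_in (f ` I) j = k} = f ` {i. i \<in> I \<and> rank_in I i = k}"
    using rank_in_image[OF f] by auto
  moreover have "inj_on f {i. i \<in> I \<and> rank_in I i = k}"
    using strict_mono_on_imp_inj_on[OF f] by (rule inj_on_subset) auto
  ultimately show "face_coordinates (f ` I) y k = face_coordinates I x k"
    using assms(2) by (simp add: face_coordinates_def sum.reindex)
qed

lemma face_coordinates_rank: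
  assumes "finite S" "i \<in> S"
  shows "face_coordinates S x (rank_in S i) = x i"
proof -
  have "{j. j \<in> S \<and> rank_in S j = rank_in S i} = {i}"
    using inj_on_rank_in[OF assms(1)] assms(2) by (auto dest: inj_onD)
  then show ?thesis by (simp add: face_coordinates_def)
qed

lemma face_coordinates_beyond:
  assumes "finite S" "card S \<le> k"
  shows "face_coordinates S x k = 0"
proof -
  have "{j. j \<in> S \<and> rank_in S j = k} = {}"
    using rank_in_less_card[OF assms(1)] assms(2) by fastforce
  then show ?thesis by (simp only: face_coordinates_def sum.empty)
qed

lemma face_inclusion_coordinates:
  assumes "finite S" "support x \<subseteq> S"
  shows "face_inclusion S (face_coordinates S x) = x"
  using assms by (auto simp: face_inclusion_def face_coordinates_rank support_def fun_eq_iff)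

lemma sum_over_rank:
  assumes "finite S" shows "(\<Sum>i\<in>S. y (rank_in S i)) = (\<Sum>k<card S. y k)"
  using sum.reindex[OF inj_on_rank_in[OF assms], of y] by (simp add: image_rank_in[OF assms])

lemma lessThan_card_eq: "\<lbrakk>finite S; S \<noteq> {}\<rbrakk> \<Longrightarrow> {..<card S} = {..card S - 1}"
  by (metis Suc_pred' card_gt_0_iff lessThan_Suc_atMost)

lemma face_inclusion_in_simplex:
  assumes "y \<in> standard_simplex (card S - 1)" "S \<subseteq> {..n}" "S \<noteq> {}"
  shows "face_inclusion S y \<in> standard_simplex n"
proof -
  have fin: "finite S" using assms finite_subset by blast
  have "(\<Sum>i\<le>n. face_inclusion S y i) = (\<Sum>i\<in>S. y (rank_in S i))"
    using assms by (intro sum.mono_neutral_cong_right) (auto simp: face_inclusion_def)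
  also have "\<dots> = (\<Sum>k\<le>card S - 1. y k)"
    by (simp only: sum_over_rank[OF fin] lessThan_card_eq[OF fin assms(3)])
  finally have sum: "(\<Sum>i\<le>n. face_inclusion S y i) = (\<Sum>k\<le>card S - 1. y k)" .
  have "(\<Sum>k\<le>card S - 1. y k) = 1" "\<And>i. 0 \<le> y i \<and> y i \<le> 1"
    using assms(1) by (simp_all add: standard_simplex_def)
  moreover have "face_inclusion S y i = 0" if "i > n" for i
    using that assms(2) by (auto simp: face_inclusion_def)
  ultimately show ?thesis
    unfolding standard_simplex_def using sum by (simp add: face_inclusion_def)
qed

lemma support_simplex:
  assumes "x \<in> standard_simplex n"
  shows "support x \<subseteq> {..n}" "support x \<noteq> {}" "finite (support x)"
proof -
  show *: "support x \<subseteq> {..n}"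
  proof
    fix i assume "i \<in> support x"
    then show "i \<in> {..n}"
      using assms not_le by (auto simp: support_def standard_simplex_def)
  qed
  have "(\<Sum>i\<le>n. x i) = 1"
    using assms by (simp add: standard_simplex_def)
  moreover have "(\<Sum>i\<le>n. x i) = 0" if "support x = {}"
    using that by (intro sum.neutral) (auto simp: support_def)
  ultimately show "support x \<noteq> {}"
    by auto
  show "finite (support x)"
    using * finite_subset by blast
qed

lemma support_open_simplex:
  assumes x: "x \<in> standard_simplex n"
  shows "x \<in> open_simplex n \<longleftrightarrow> support x = {..n}"
proof -
  have "0 \<le> x i" for i using x by (simp add: standard_simplex_def)
  then have "0 < x i \<longleftrightarrow> i \<in> support x" for i by (simp add: support_def less_le)
  then show ?thesis
    using x support_simplex(1)[OF x] by (auto simp: open_simplex_def)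
qed

lemma face_coordinates_in_open_simplex:
  assumes x: "x \<in> standard_simplex n"
  shows "face_coordinates (support x) x \<in> open_simplex (card (support x) - 1)"
proof -
  let ?S = "support x"
  note S = support_simplex[OF x]
  have val: "\<exists>i\<in>?S. face_coordinates ?S x k = x i" if "k < card ?S" for k
  proof -
    from that obtain i where "i \<in> ?S" "k = rank_in ?S i"
      using image_rank_in[OF S(3)] by blast
    then show ?thesis using face_coordinates_rank[OF S(3)] by blast
  qed
  have x01: "0 \<le> x i" "x i \<le> 1" for i using x by (auto simp: standard_simplex_def)
  have pos: "0 < face_coordinates ?S x k" if "k < card ?S" for k
    using val[OF that] x01 by (auto simp: support_def less_le)
  have "0 \<le> face_coordinates ?S x k \<and> face_coordinates ?S x k \<le> 1" for k
    using val[of k] x01 face_coordinates_beyond[OF S(3), of k x] by (cases "k < card ?S") auto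
  moreover have "(\<Sum>k\<le>card ?S - 1. face_coordinates ?S x k) = 1"
  proof -
    have "(\<Sum>k\<le>card ?S - 1. face_coordinates ?S x k) = (\<Sum>i\<in>?S. face_coordinates ?S x (rank_in ?S i))"
      by (simp only: sum_over_rank[OF S(3)] lessThan_card_eq[OF S(3,2)])
    also have "\<dots> = (\<Sum>i\<in>?S. x i)"
      by (rule sum.cong) (auto simp: face_coordinates_rank S)
    also have "\<dots> = (\<Sum>i\<le>n. x i)"
      by (rule sum.mono_neutral_left) (use S in \<open>auto simp: support_def\<close>)
    finally show ?thesis using x by (simp add: standard_simplex_def)
  qed
  moreover have "face_coordinates ?S x k = 0" if "k > card ?S - 1" for k
    using that by (intro face_coordinates_beyond S) auto
  ultimately show ?thesis
    using pos lessThan_card_eq[OF S(3,2)] by (auto simp: open_simplex_def standard_simplex_def)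
qed

lemma face_inclusion_face_inclusion:
  assumes "finite S" "I \<subseteq> S"
  shows "face_inclusion S (face_inclusion (rank_in S ` I) y) = face_inclusion I y"
proof
  fix i
  have mono: "strict_mono_on I (rank_in S)"
    using strict_mono_on_rank_in[OF assms(1)] assms(2) by (auto simp: strict_mono_on_def)
  have "rank_in S i \<in> rank_in S ` I \<longleftrightarrow> i \<in> I" if "i \<in> S"
    using that assms inj_on_rank_in[OF assms(1)] by (auto dest: inj_onD)
  then show "face_inclusion S (face_inclusion (rank_in S ` I) y) i = face_inclusion I y i"
    using assms(2) rank_in_image[OF mono] by (auto simp: face_inclusion_def)
qed

lemma face_on_face_on:
  assumes "finite S" "I \<subseteq> S" "I \<noteq> {}"
  shows "face_on (rank_in S ` I) (face_on S \<sigma>) = face_on I \<sigma>"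
proof -
  have S: "S \<noteq> {}" using assms by auto
  have "inj_on (rank_in S) I"
    using inj_on_rank_in[OF assms(1)] assms(2) by (rule inj_on_subset)
  then have card: "card (rank_in S ` I) = card I" by (rule card_image)
  have "rank_in S ` I \<subseteq> {..card S - 1}"
    using image_rank_in[OF assms(1)] lessThan_card_eq[OF assms(1) S] assms(2) by blast
  then have "face_inclusion (rank_in S ` I) y \<in> standard_simplex (card S - 1)"
    if "y \<in> standard_simplex (card I - 1)" for y
    using that assms by (intro face_inclusion_in_simplex) (auto simp: card)
  then show ?thesis
    by (auto simp: face_on_def card face_inclusion_face_inclusion[OF assms(1,2)] restrict_def intro!: ext)
qed

lemma singular_simplex_face_on:
  assumes \<sigma>: "singular_simplex n V \<sigma>" and S: "S \<subseteq> {..n}" "S \<noteq> {}"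
  shows "singular_simplex (card S - 1) V (face_on S \<sigma>)"
proof -
  have "continuous_map (powertop_real UNIV) euclideanreal (\<lambda>x. face_inclusion S x i)" for i
    using continuous_map_product_projection[of "rank_in S i" UNIV "\<lambda>_. euclideanreal"]
    by (cases "i \<in> S") (simp_all add: face_inclusion_def)
  then have "continuous_map (simplex_space (card S - 1)) (powertop_real UNIV) (face_inclusion S)"
    by (intro continuous_map_from_subtopology) (simp add: continuous_map_componentwise_UNIV)
  then have "continuous_map (simplex_space (card S - 1)) (simplex_space n) (face_inclusion S)"
    using S face_inclusion_in_simplex[OF _ S]
    by (simp add: continuous_map_in_subtopology Pi_iff)
  moreover have "continuous_map (simplex_space n) V \<sigma>"
    using \<sigma> by (simp add: singular_simplex_def)
  ultimately have "continuous_map (simplex_space (card S - 1)) V (\<sigma> \<circ> face_inclusion S)"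
    by (rule continuous_map_compose)
  then show ?thesis
    by (simp add: singular_simplex_def face_on_def)
qed

lemma face_inclusion_all:
  assumes "y \<in> standard_simplex n" shows "face_inclusion {..n} y = y"
proof
  fix i
  have "i > n \<Longrightarrow> y i = 0" using assms by (simp add: standard_simplex_def)
  then show "face_inclusion {..n} y i = y i"
    by (cases "i \<le> n") (simp_all add: face_inclusion_def rank_in_atMost)
qed

lemma face_coordinates_all:
  assumes "y \<in> standard_simplex n" shows "face_coordinates {..n} y = y"
proof
  fix k
  show "face_coordinates {..n} y k = y k"
  proof (cases "k \<le> n")
    case True
    then show ?thesis using face_coordinates_rank[of "{..n}" k y] by (simp add: rank_in_atMost)
  next
    case False
    then show ?thesis using assms face_coordinates_beyond[of "{..n}" k y] by (simp add: standard_simplex_def)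
  qed
qed

lemma face_on_all:
  assumes "singular_simplex n V \<sigma>" shows "face_on {..n} \<sigma> = \<sigma>"
proof -
  have "face_on {..n} \<sigma> = restrict \<sigma> (standard_simplex n)"
    by (auto simp: face_on_def face_inclusion_all restrict_def)
  then show ?thesis
    using assms extensional_restrict by (auto simp: singular_simplex_def)
qed

lemma simplex_point_open:
  assumes "singular_simplex n V \<sigma>" "x \<in> open_simplex n"
  shows "simplex_point \<sigma> x = (\<sigma>, x)"
proof -
  have x: "x \<in> standard_simplex n" using assms by (simp add: open_simplex_def)
  then have "support x = {..n}" using support_open_simplex assms by blast
  then show ?thesis
    using x assms by (simp add: simplex_point_def face_on_all face_coordinates_all)
qed

lemma simplex_point_eval:
  assumes "x \<in> standard_simplex n"
  shows "fst (simplex_point \<sigma> x) (snd (simplex_point \<sigma> x)) = \<sigma> x"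
proof -
  note S = support_simplex[OF assms]
  have "face_coordinates (support x) x \<in> standard_simplex (card (support x) - 1)"
    using face_coordinates_in_open_simplex[OF assms] by (simp add: open_simplex_def)
  then show ?thesis
    by (simp add: simplex_point_def face_on_def face_inclusion_coordinates S)
qed

text \<open>
  The gluing of the realisation along faces. The face inclusion renumbers the vertices by the
  increasing map \<open>\<delta>\<close> omitting \<open>k\<close>, and ranks do not change under increasing maps.
\<close>

lemma simplex_point_face:
  assumes x: "x \<in> standard_simplex n" and k: "k \<le> Suc n"
  shows "simplex_point (singular_face (Suc n) k \<sigma>) x = simplex_point \<sigma> (simplical_face k x)"
proof -
  define \<delta> where "\<delta> i = (if i < k then i else Suc i)" for i
  have mono: "strict_mono_on I \<delta>" for I
    by (auto simp: strict_mono_on_def \<delta>_def)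
  let ?S = "support x" and ?x = "simplical_face k x"
  have val: "?x (\<delta> i) = x i" for i
    by (auto simp: \<delta>_def simplical_face_def)
  have range: "i = k \<or> (\<exists>j. i = \<delta> j)" for i
  proof (cases "i < k")
    case False
    then show ?thesis by (cases i) (auto simp: \<delta>_def intro!: exI[of _ "i - 1"])
  qed (auto simp: \<delta>_def intro!: exI[of _ i])
  have k0: "?x k = 0" "k \<noteq> \<delta> j" for j
    by (auto simp: \<delta>_def simplical_face_def)
  have supp: "support ?x = \<delta> ` ?S"
    using range val k0 by (auto simp: support_def image_iff) metis
  note S = support_simplex[OF x]
  have card: "card (\<delta> ` ?S) = card ?S"
    using strict_mono_on_imp_inj_on[OF mono] by (rule card_image)
  have incl: "simplical_face k (face_inclusion ?S y) = face_inclusion (\<delta> ` ?S) y" for y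
  proof
    fix i
    show "simplical_face k (face_inclusion ?S y) i = face_inclusion (\<delta> ` ?S) y i"
    proof (cases "i = k")
      case True
      then show ?thesis using k0(2) by (auto simp: simplical_face_def face_inclusion_def)
    next
      case False
      then obtain j where j: "i = \<delta> j" using range by blast
      have "simplical_face k (face_inclusion ?S y) (\<delta> j) = face_inclusion ?S y j"
        by (auto simp: \<delta>_def simplical_face_def)
      moreover have "\<delta> j \<in> \<delta> ` ?S \<longleftrightarrow> j \<in> ?S"
        using strict_mono_on_imp_inj_on[OF mono, of UNIV] by (simp add: inj_image_mem_iff)
      ultimately show ?thesis
        using rank_in_image[OF mono, of j ?S] j by (auto simp: face_inclusion_def)
    qed
  qed
  have "face_on ?S (singular_face (Suc n) k \<sigma>) = face_on (\<delta> ` ?S) \<sigma>"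
    using face_inclusion_in_simplex[OF _ S(1,2)]
    by (auto simp: face_on_def card singular_face_def restrict_def incl intro!: ext)
  moreover have "face_coordinates (\<delta> ` ?S) ?x = face_coordinates ?S x"
    by (rule face_coordinates_image[OF mono]) (simp add: val)
  ultimately show ?thesis
    by (simp add: simplex_point_def supp)
qed

section \<open>The skeleton of the fat realisation\<close>

definition skeleton_points :: "nat \<Rightarrow> 'a topology \<Rightarrow> 'a realisation_point set" where
  "skeleton_points m V = {(\<sigma>, x). \<exists>n\<le>m. singular_simplex n V \<sigma> \<and> x \<in> open_simplex n}"

text \<open>
  The finest topology for which the characteristic maps of all singular simplices of dimension at
  most \<open>m\<close> are continuous. A map out of the skeleton is therefore continuous as soon as its
  composites with these maps of closed simplices are.
\<close>

definition skeleton :: "nat \<Rightarrow> 'a topology \<Rightarrow> 'a realisation_point topology" where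
  "skeleton m V = topology (\<lambda>W. W \<subseteq> skeleton_points m V \<and>
     (\<forall>n \<sigma>. n \<le> m \<and> singular_simplex n V \<sigma> \<longrightarrow>
        openin (simplex_space n) {x \<in> standard_simplex n. simplex_point \<sigma> x \<in> W}))"

lemma openin_skeleton:
  "openin (skeleton m V) W \<longleftrightarrow> W \<subseteq> skeleton_points m V \<and>
     (\<forall>n \<sigma>. n \<le> m \<and> singular_simplex n V \<sigma> \<longrightarrow>
        openin (simplex_space n) {x \<in> standard_simplex n. simplex_point \<sigma> x \<in> W})"
proof -
  let ?L = "\<lambda>W. W \<subseteq> skeleton_points m V \<and>
     (\<forall>n \<sigma>. n \<le> m \<and> singular_simplex n V \<sigma> \<longrightarrow>
        openin (simplex_space n) {x \<in> standard_simplex n. simplex_point \<sigma> x \<in> W})"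
  have "istopology ?L"
    unfolding istopology_def
  proof (intro conjI allI impI)
    fix S T assume S: "?L S" and T: "?L T"
    show "S \<inter> T \<subseteq> skeleton_points m V" using S by auto
    fix n \<sigma> assume n: "n \<le> m \<and> singular_simplex n V \<sigma>"
    have "{x \<in> standard_simplex n. simplex_point \<sigma> x \<in> S \<inter> T} =
        {x \<in> standard_simplex n. simplex_point \<sigma> x \<in> S} \<inter> {x \<in> standard_simplex n. simplex_point \<sigma> x \<in> T}"
      by auto
    then show "openin (simplex_space n) {x \<in> standard_simplex n. simplex_point \<sigma> x \<in> S \<inter> T}"
      using openin_Int[of "simplex_space n"] S T n by simp
  next
    fix K assume K: "\<forall>S\<in>K. ?L S"
    show "\<Union>K \<subseteq> skeleton_points m V" using K by auto
    fix n \<sigma> assume n: "n \<le> m \<and> singular_simplex n V \<sigma>"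
    have "{x \<in> standard_simplex n. simplex_point \<sigma> x \<in> \<Union>K} =
        \<Union>((\<lambda>S. {x \<in> standard_simplex n. simplex_point \<sigma> x \<in> S}) ` K)"
      by auto
    moreover have "openin (simplex_space n) (\<Union>((\<lambda>S. {x \<in> standard_simplex n. simplex_point \<sigma> x \<in> S}) ` K))"
      using K n by (intro openin_Union) blast
    ultimately show "openin (simplex_space n) {x \<in> standard_simplex n. simplex_point \<sigma> x \<in> \<Union>K}"
      by simp
  qed
  then show ?thesis
    unfolding skeleton_def by (simp add: topology_inverse')
qed

lemma simplex_point_in_skeleton_points:
  assumes "n \<le> m" "singular_simplex n V \<sigma>" "x \<in> standard_simplex n"
  shows "simplex_point \<sigma> x \<in> skeleton_points m V"
proof -
  note S = support_simplex[OF assms(3)]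
  have "card (support x) - 1 \<le> m"
    using card_mono[OF _ S(1)] assms(1) by simp
  then show ?thesis
    using singular_simplex_face_on[OF assms(2) S(1,2)] face_coordinates_in_open_simplex[OF assms(3)]
    by (auto simp: skeleton_points_def simplex_point_def)
qed

lemma topspace_skeleton: "topspace (skeleton m V) = skeleton_points m V"
proof -
  have "openin (skeleton m V) (skeleton_points m V)"
    unfolding openin_skeleton
  proof (intro conjI allI impI)
    fix n \<sigma> assume "n \<le> m \<and> singular_simplex n V \<sigma>"
    then have "{x \<in> standard_simplex n. simplex_point \<sigma> x \<in> skeleton_points m V} = topspace (simplex_space n)"
      using simplex_point_in_skeleton_points by auto
    then show "openin (simplex_space n) {x \<in> standard_simplex n. simplex_point \<sigma> x \<in> skeleton_points m V}"
      by (metis openin_topspace)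
  qed simp
  then show ?thesis
    by (meson openin_skeleton openin_subset openin_topspace subset_antisym)
qed

lemma continuous_map_simplex_point:
  assumes "n \<le> m" "singular_simplex n V \<sigma>"
  shows "continuous_map (simplex_space n) (skeleton m V) (simplex_point \<sigma>)"
  unfolding continuous_map_def
proof (intro conjI allI impI)
  show "simplex_point \<sigma> \<in> topspace (simplex_space n) \<rightarrow> topspace (skeleton m V)"
    using simplex_point_in_skeleton_points[OF assms] by (simp add: topspace_skeleton Pi_iff)
  fix W assume "openin (skeleton m V) W"
  then show "openin (simplex_space n) {x \<in> topspace (simplex_space n). simplex_point \<sigma> x \<in> W}"
    using assms unfolding openin_skeleton by simp
qed

lemma continuous_map_from_skeleton:
  assumes "\<And>n \<sigma>. \<lbrakk>n \<le> m; singular_simplex n V \<sigma>\<rbrakk>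
             \<Longrightarrow> continuous_map (simplex_space n) Z (\<lambda>x. F (simplex_point \<sigma> x))"
  shows "continuous_map (skeleton m V) Z F"
  unfolding continuous_map_def
proof (intro conjI allI impI)
  show "F \<in> topspace (skeleton m V) \<rightarrow> topspace Z"
  proof
    fix p assume "p \<in> topspace (skeleton m V)"
    then obtain n \<sigma> x where p: "p = (\<sigma>, x)" "n \<le> m" "singular_simplex n V \<sigma>" "x \<in> open_simplex n"
      by (auto simp: topspace_skeleton skeleton_points_def)
    then have "F (simplex_point \<sigma> x) \<in> topspace Z"
      using assms[of n \<sigma>] by (auto simp: continuous_map_def open_simplex_def)
    then show "F p \<in> topspace Z" using p(1) simplex_point_open[OF p(3,4)] by simp
  qed
  fix W assume W: "openin Z W"
  show "openin (skeleton m V) {x \<in> topspace (skeleton m V). F x \<in> W}"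
    unfolding openin_skeleton
  proof (intro conjI allI impI)
    fix n \<sigma> assume n: "n \<le> m \<and> singular_simplex n V \<sigma>"
    have "{x \<in> standard_simplex n. simplex_point \<sigma> x \<in> {x \<in> topspace (skeleton m V). F x \<in> W}} =
          {x \<in> topspace (simplex_space n). F (simplex_point \<sigma> x) \<in> W}"
      using n simplex_point_in_skeleton_points by (auto simp: topspace_skeleton)
    then show "openin (simplex_space n)
        {x \<in> standard_simplex n. simplex_point \<sigma> x \<in> {x \<in> topspace (skeleton m V). F x \<in> W}}"
      using openin_continuous_map_preimage[OF assms[of n \<sigma>] W] n by simp
  qed (auto simp: topspace_skeleton)
qed

lemma closedin_skeleton:
  "closedin (skeleton m V) A \<longleftrightarrow> A \<subseteq> skeleton_points m V \<and>
     (\<forall>n \<sigma>. n \<le> m \<and> singular_simplex n V \<sigma> \<longrightarrow>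
        closedin (simplex_space n) {x \<in> standard_simplex n. simplex_point \<sigma> x \<in> A})"
proof -
  have eq: "openin (simplex_space n) {x \<in> standard_simplex n. simplex_point \<sigma> x \<in> skeleton_points m V - A}
     \<longleftrightarrow> closedin (simplex_space n) {x \<in> standard_simplex n. simplex_point \<sigma> x \<in> A}"
    if "n \<le> m" "singular_simplex n V \<sigma>" for n \<sigma>
  proof -
    have "{x \<in> standard_simplex n. simplex_point \<sigma> x \<in> skeleton_points m V - A} =
        topspace (simplex_space n) - {x \<in> standard_simplex n. simplex_point \<sigma> x \<in> A}"
      using simplex_point_in_skeleton_points[OF that] by auto
    then show ?thesis by (simp add: closedin_def)
  qed
  have "closedin (skeleton m V) A \<longleftrightarrow>
      A \<subseteq> skeleton_points m V \<and> openin (skeleton m V) (skeleton_points m V - A)"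
    by (simp add: closedin_def topspace_skeleton)
  also have "openin (skeleton m V) (skeleton_points m V - A) \<longleftrightarrow>
     (\<forall>n \<sigma>. n \<le> m \<and> singular_simplex n V \<sigma> \<longrightarrow>
        openin (simplex_space n) {x \<in> standard_simplex n. simplex_point \<sigma> x \<in> skeleton_points m V - A})"
    unfolding openin_skeleton by blast
  finally show ?thesis
    using eq by simp
qed

text \<open>
  Functions that separate the points of the realisation. The sum runs over the faces of \<open>(\<sigma>, x)\<close>
  equal to \<open>\<tau>\<close>, each weighted by the product of the barycentric coordinates of \<open>x\<close> at its vertices
  and by a function \<open>\<psi>\<close> of these coordinates. The product vanishes on the faces that do
  not contain \<open>I\<close>, so the functions obtained on the individual simplices agree on common faces.
\<close>

definition face_detector ::
  "nat \<Rightarrow> ((nat \<Rightarrow> real) \<Rightarrow> 'a) \<Rightarrow> ((nat \<Rightarrow> real) \<Rightarrow> real) \<Rightarrow> 'a realisation_point \<Rightarrow> real" where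
  "face_detector d \<tau> \<psi> = (\<lambda>(\<sigma>, x).
     \<Sum>I | I \<subseteq> support x \<and> card I = Suc d \<and> face_on I \<sigma> = \<tau>. (\<Prod>i\<in>I. x i) * \<psi> (face_coordinates I x))"

lemma support_face_coordinates:
  assumes "x \<in> standard_simplex n"
  shows "support (face_coordinates (support x) x) = rank_in (support x) ` support x"
proof -
  note S = support_simplex[OF assms]
  have "face_coordinates (support x) x \<in> standard_simplex (card (support x) - 1)"
    "face_coordinates (support x) x \<in> open_simplex (card (support x) - 1)"
    using face_coordinates_in_open_simplex[OF assms] by (simp_all add: open_simplex_def)
  then have "support (face_coordinates (support x) x) = {..card (support x) - 1}"
    using support_open_simplex by blast
  then show ?thesis
    by (simp only: image_rank_in[OF S(3)] lessThan_card_eq[OF S(3,2)])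
qed

text \<open>
  The set of vertices \<open>I\<close> of \<open>\<sigma>\<close> inside the support \<open>S\<close> of \<open>x\<close> corresponds to the set of
  its ranks in the face spanned by \<open>S\<close>. Neither the face, nor the coordinates, nor the
  product depend on which of the two descriptions is used.
\<close>

lemma face_detector_simplex_point:
  assumes x: "x \<in> standard_simplex n"
  shows "face_detector d \<tau> \<psi> (simplex_point \<sigma> x) = face_detector d \<tau> \<psi> (\<sigma>, x)"
proof -
  let ?S = "support x" and ?x = "face_coordinates (support x) x"
  let ?r = "rank_in ?S"
  note S = support_simplex[OF x]
  have inj: "inj_on ?r I" if "I \<subseteq> ?S" for I
    using inj_on_rank_in[OF S(3)] that by (rule inj_on_subset)
  have mono: "strict_mono_on I ?r" if "I \<subseteq> ?S" for I
    using strict_mono_on_rank_in[OF S(3)] that by (auto simp: strict_mono_on_def)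
  have card: "card (?r ` I) = card I" if "I \<subseteq> ?S" for I
    using inj[OF that] by (rule card_image)
  have face: "face_on (?r ` I) (face_on ?S \<sigma>) = face_on I \<sigma>" if "I \<subseteq> ?S" "card I = Suc d" for I
    by (rule face_on_face_on) (use that S in auto)
  have sets: "{J. J \<subseteq> support ?x \<and> card J = Suc d \<and> face_on J (face_on ?S \<sigma>) = \<tau>} =
        (`) ?r ` {I. I \<subseteq> ?S \<and> card I = Suc d \<and> face_on I \<sigma> = \<tau>}" (is "?A = _ ` ?B")
  proof
    show "?A \<subseteq> (`) ?r ` ?B"
    proof
      fix J assume J: "J \<in> ?A"
      then obtain I where I: "I \<subseteq> ?S" "J = ?r ` I"
        by (auto simp: support_face_coordinates[OF x] subset_image_iff)
      then have "card I = Suc d" using J card by auto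
      then show "J \<in> (`) ?r ` ?B" using I J face by auto
    qed
    show "(`) ?r ` ?B \<subseteq> ?A"
      using card face by (auto simp: support_face_coordinates[OF x])
  qed
  have injB: "inj_on ((`) ?r) ?B"
    using inj_on_image_eq_iff[OF inj[OF order_refl]] by (auto simp: inj_on_def)
  have term_eq: "(\<Prod>j\<in>?r ` I. ?x j) * \<psi> (face_coordinates (?r ` I) ?x) =
        (\<Prod>i\<in>I. x i) * \<psi> (face_coordinates I x)" if "I \<subseteq> ?S" for I
  proof -
    have val: "?x (?r i) = x i" if "i \<in> I" for i
      by (rule face_coordinates_rank[OF S(3)]) (use that \<open>I \<subseteq> ?S\<close> in auto)
    have "(\<Prod>j\<in>?r ` I. ?x j) = (\<Prod>i\<in>I. x i)"
      using val by (simp add: prod.reindex[OF inj[OF that]])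
    moreover have "face_coordinates (?r ` I) ?x = face_coordinates I x"
      by (rule face_coordinates_image[OF mono[OF that]]) (rule val)
    ultimately show ?thesis by simp
  qed
  have "face_detector d \<tau> \<psi> (simplex_point \<sigma> x) =
      (\<Sum>J\<in>?A. (\<Prod>j\<in>J. ?x j) * \<psi> (face_coordinates J ?x))"
    by (simp add: face_detector_def simplex_point_def)
  also have "\<dots> = (\<Sum>I\<in>?B. (\<Prod>j\<in>?r ` I. ?x j) * \<psi> (face_coordinates (?r ` I) ?x))"
    unfolding sets by (subst sum.reindex[OF injB]) simp
  also have "\<dots> = (\<Sum>I\<in>?B. (\<Prod>i\<in>I. x i) * \<psi> (face_coordinates I x))"
    by (rule sum.cong) (auto simp: term_eq)
  finally show ?thesis
    by (simp add: face_detector_def)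
qed

lemma continuous_map_face_detector:
  assumes \<psi>: "continuous_map (powertop_real UNIV) euclideanreal \<psi>"
  shows "continuous_map (skeleton m V) euclideanreal (face_detector d \<tau> \<psi>)"
proof (rule continuous_map_from_skeleton)
  fix n \<sigma> assume "n \<le> m" "singular_simplex n V \<sigma>"
  let ?F = "\<lambda>I x. (\<Prod>i\<in>I. x i) * \<psi> (face_coordinates I x)"
  let ?A = "{I. I \<subseteq> {..n} \<and> card I = Suc d \<and> face_on I \<sigma> = \<tau>}"
  have fin: "finite ?A" by (rule finite_subset[of _ "Pow {..n}"]) auto
  have proj: "continuous_map (powertop_real UNIV) euclideanreal (\<lambda>x::nat \<Rightarrow> real. x i)" for i
    by (rule continuous_map_product_projection) simp
  have "continuous_map (powertop_real UNIV) (powertop_real UNIV) (face_coordinates I)" if "finite I" for I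
    unfolding continuous_map_componentwise_UNIV face_coordinates_def
    using that by (intro allI continuous_map_sum proj) auto
  from continuous_map_compose[OF this \<psi>]
  have "continuous_map (powertop_real UNIV) euclideanreal (?F I)" if "finite I" for I
    using that by (intro continuous_map_real_mult continuous_map_prod proj) (auto simp: o_def)
  then have "continuous_map (powertop_real UNIV) euclideanreal (\<lambda>x. \<Sum>I\<in>?A. ?F I x)"
    using fin finite_subset by (intro continuous_map_sum) auto
  then have "continuous_map (simplex_space n) euclideanreal (\<lambda>x. \<Sum>I\<in>?A. ?F I x)"
    by (rule continuous_map_from_subtopology)
  then show "continuous_map (simplex_space n) euclideanreal (\<lambda>x. face_detector d \<tau> \<psi> (simplex_point \<sigma> x))"
  proof (rule continuous_map_eq)
    fix x assume "x \<in> topspace (simplex_space n)"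
    then have x: "x \<in> standard_simplex n" by simp
    \<comment> \<open>On the closed simplex the index set \<open>?A\<close> is fixed: the sets of vertices outside the support of
        \<open>x\<close> contribute nothing.\<close>
    have zero: "?F I x = 0" if I: "I \<in> ?A" "\<not> I \<subseteq> support x" for I
    proof -
      obtain i where "i \<in> I" "x i = 0" using I(2) by (auto simp: support_def)
      moreover have "finite I" using I(1) finite_subset by auto
      ultimately show ?thesis by (simp add: prod_zero_iff) blast
    qed
    have "face_detector d \<tau> \<psi> (\<sigma>, x) =
        (\<Sum>I | I \<subseteq> support x \<and> card I = Suc d \<and> face_on I \<sigma> = \<tau>. ?F I x)"
      by (simp add: face_detector_def)
    also have "\<dots> = (\<Sum>I\<in>?A. ?F I x)"
      using support_simplex(1)[OF x] fin zero by (intro sum.mono_neutral_left) auto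
    finally show "(\<Sum>I\<in>?A. ?F I x) = face_detector d \<tau> \<psi> (simplex_point \<sigma> x)"
      by (simp add: face_detector_simplex_point[OF x])
  qed
qed

lemma face_detector_top:
  assumes \<sigma>: "singular_simplex n V \<sigma>" and x: "x \<in> open_simplex n" and "n \<le> d"
  shows "face_detector d \<tau> \<psi> (\<sigma>, x) = (if n = d \<and> \<sigma> = \<tau> then (\<Prod>i\<le>n. x i) * \<psi> x else 0)"
proof -
  have x': "x \<in> standard_simplex n" using x by (simp add: open_simplex_def)
  have supp: "support x = {..n}" using support_open_simplex[OF x'] x by simp
  have uniq: "I = {..n} \<and> n = d" if "I \<subseteq> {..n}" "card I = Suc d" for I
  proof -
    have "card I \<le> Suc n" using card_mono[OF _ that(1)] by simp
    with that assms(3) have "card I = card {..n}" "n = d" by simp_all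
    then show ?thesis using that(1) card_subset_eq by blast
  qed
  have "I \<subseteq> support x \<and> card I = Suc d \<and> face_on I \<sigma> = \<tau> \<longleftrightarrow> I = {..n} \<and> n = d \<and> \<sigma> = \<tau>" for I
    unfolding supp using face_on_all[OF \<sigma>] uniq[of I] by auto
  then have "{I. I \<subseteq> support x \<and> card I = Suc d \<and> face_on I \<sigma> = \<tau>} =
      (if n = d \<and> \<sigma> = \<tau> then {{..n}} else {})"
    by auto
  then show ?thesis
    unfolding face_detector_def prod.case
    using face_coordinates_all[OF x'] by (cases "n = d \<and> \<sigma> = \<tau>") (simp_all only: if_True if_False, auto)
qed

lemma Hausdorff_space_if_real_separated:
  assumes "\<And>p p'. \<lbrakk>p \<in> topspace P; p' \<in> topspace P; p \<noteq> p'\<rbrakk>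
             \<Longrightarrow> \<exists>F. continuous_map P euclideanreal F \<and> F p \<noteq> F p'"
  shows "Hausdorff_space P"
  unfolding Hausdorff_space_def
proof (intro allI impI)
  fix p p' assume *: "p \<in> topspace P \<and> p' \<in> topspace P \<and> p \<noteq> p'"
  then obtain F where F: "continuous_map P euclideanreal F" "F p \<noteq> F p'"
    using assms by blast
  then obtain U W where UW: "open U" "open W" "F p \<in> U" "F p' \<in> W" "U \<inter> W = {}"
    using hausdorff by metis
  let ?f = "\<lambda>U. {x \<in> topspace P. F x \<in> U}"
  have "openin P (?f U)" "openin P (?f W)"
    using UW F(1) by (auto intro: openin_continuous_map_preimage)
  moreover have "disjnt (?f U) (?f W)" using UW(5) by (auto simp: disjnt_def)
  ultimately show "\<exists>U V. openin P U \<and> openin P V \<and> p \<in> U \<and> p' \<in> V \<and> disjnt U V"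
    using * UW by (intro exI[of _ "?f U"] exI[of _ "?f W"]) auto
qed

text \<open>
  Points in different open cells are separated by the detector of one of the two cells whose
  dimension is not the smaller one. Points in the same cell are separated by the detector of that cell, with weight \<open>1\<close>
  if the products of their coordinates differ and with a coordinate as weight otherwise.
\<close>

lemma Hausdorff_skeleton: "Hausdorff_space (skeleton m V)"
proof (rule Hausdorff_space_if_real_separated)
  fix p p' assume p: "p \<in> topspace (skeleton m V)" "p' \<in> topspace (skeleton m V)" "p \<noteq> p'"
  obtain \<sigma> x a where \<sigma>: "p = (\<sigma>, x)" "singular_simplex a V \<sigma>" "x \<in> open_simplex a"
    using p(1) by (auto simp: topspace_skeleton skeleton_points_def)
  obtain \<tau> y b where \<tau>: "p' = (\<tau>, y)" "singular_simplex b V \<tau>" "y \<in> open_simplex b"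
    using p(2) by (auto simp: topspace_skeleton skeleton_points_def)
  have pos: "0 < (\<Prod>i\<le>n. z i)" if "z \<in> open_simplex n" for z n
    using that by (intro prod_pos) (simp add: open_simplex_def)
  have one: "continuous_map (powertop_real UNIV) euclideanreal (\<lambda>x::nat \<Rightarrow> real. 1)"
    by simp
  have proj: "continuous_map (powertop_real UNIV) euclideanreal (\<lambda>x::nat \<Rightarrow> real. x i)" for i
    by (rule continuous_map_product_projection) simp
  show "\<exists>F. continuous_map (skeleton m V) euclideanreal F \<and> F p \<noteq> F p'"
  proof (cases "a = b \<and> \<sigma> = \<tau>")
    case False
    show ?thesis
    proof (cases "a \<le> b")
      case True
      have "face_detector b \<tau> (\<lambda>_. 1) p = 0"
        using False True by (auto simp: \<sigma>(1) face_detector_top[OF \<sigma>(2,3)])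
      moreover have "face_detector b \<tau> (\<lambda>_. 1) p' = (\<Prod>i\<le>b. y i)"
        by (simp add: \<tau>(1) face_detector_top[OF \<tau>(2,3)])
      ultimately have "face_detector b \<tau> (\<lambda>_. 1) p \<noteq> face_detector b \<tau> (\<lambda>_. 1) p'"
        using pos[OF \<tau>(3)] by linarith
      then show ?thesis using continuous_map_face_detector[OF one] by blast
    next
      case ab: False
      have "face_detector a \<sigma> (\<lambda>_. 1) p' = 0"
        using ab by (simp add: \<tau>(1) face_detector_top[OF \<tau>(2,3)])
      moreover have "face_detector a \<sigma> (\<lambda>_. 1) p = (\<Prod>i\<le>a. x i)"
        by (simp add: \<sigma>(1) face_detector_top[OF \<sigma>(2,3)])
      ultimately have "face_detector a \<sigma> (\<lambda>_. 1) p \<noteq> face_detector a \<sigma> (\<lambda>_. 1) p'"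
        using pos[OF \<sigma>(3)] by linarith
      then show ?thesis using continuous_map_face_detector[OF one] by blast
    qed
  next
    case True
    then obtain i where i: "x i \<noteq> y i" using p(3) \<sigma>(1) \<tau>(1) by auto
    have val: "face_detector a \<sigma> \<psi> p = (\<Prod>i\<le>a. x i) * \<psi> x" 
              "face_detector a \<sigma> \<psi> p' = (\<Prod>i\<le>a. y i) * \<psi> y" for \<psi>
      using face_detector_top[OF \<sigma>(2,3) order_refl, of \<sigma> \<psi>]
        face_detector_top[OF \<tau>(2,3), of a \<sigma> \<psi>] True by (simp_all add: \<sigma>(1) \<tau>(1))
    show ?thesis
    proof (cases "(\<Prod>i\<le>a. x i) = (\<Prod>i\<le>a. y i)")
      case False
      then have "face_detector a \<sigma> (\<lambda>_. 1) p \<noteq> face_detector a \<sigma> (\<lambda>_. 1) p'"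
        by (simp add: val)
      then show ?thesis using continuous_map_face_detector[OF one] by blast
    next
      case True
      have "face_detector a \<sigma> (\<lambda>x. x i) p \<noteq> face_detector a \<sigma> (\<lambda>x. x i) p'"
      proof -
        have "(\<Prod>i\<le>a. y i) \<noteq> 0" using pos[OF \<sigma>(3)] True by linarith
        then show ?thesis using i by (simp only: val True mult_cancel_left simp_thms)
      qed
      then show ?thesis using continuous_map_face_detector[OF proj] by blast
    qed
  qed
qed

section \<open>The cell structure\<close>

definition cell_map :: "nat \<Rightarrow> ((nat \<Rightarrow> real) \<Rightarrow> 'a) \<Rightarrow> (nat \<Rightarrow> real) \<Rightarrow> 'a realisation_point" where
  "cell_map n \<sigma> = simplex_point \<sigma> \<circ> disc_to_simplex n"

definition skeleton_cells :: "nat \<Rightarrow> 'a topology \<Rightarrow> (nat \<times> ((nat \<Rightarrow> real) \<Rightarrow> 'a realisation_point)) set" where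
  "skeleton_cells m V = {(n, cell_map n \<sigma>) | n \<sigma>. n \<le> m \<and> singular_simplex n V \<sigma>}"

lemma open_simplex_unique:
  assumes "x \<in> open_simplex a" "x \<in> open_simplex b"
  shows "a = b"
proof -
  have "support x = {..a}" "support x = {..b}"
    using assms support_open_simplex by (auto simp: open_simplex_def)
  then show ?thesis by (metis atMost_eq_iff)
qed

lemma cell_map_image_open:
  assumes "singular_simplex n V \<sigma>"
  shows "cell_map n \<sigma> ` open_unit_disc n = {\<sigma>} \<times> open_simplex n"
proof -
  have "cell_map n \<sigma> ` open_unit_disc n = simplex_point \<sigma> ` open_simplex n"
    by (simp only: cell_map_def image_comp[symmetric] disc_to_simplex_image_open_disc)
  also have "\<dots> = Pair \<sigma> ` open_simplex n"
    by (rule image_cong) (simp_all add: simplex_point_open[OF assms])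
  finally show ?thesis by auto
qed

lemma cell_map_image_disc: "cell_map n \<sigma> ` unit_disc n = simplex_point \<sigma> ` standard_simplex n"
  by (simp only: cell_map_def image_comp[symmetric] disc_to_simplex_image_disc)

lemma continuous_map_cell_map:
  assumes "n \<le> m" "singular_simplex n V \<sigma>"
  shows "continuous_map (subtopology (Euclidean_space n) (unit_disc n)) (skeleton m V) (cell_map n \<sigma>)"
  unfolding cell_map_def
  by (rule continuous_map_compose[OF continuous_map_disc_to_simplex continuous_map_simplex_point[OF assms]])

lemma closed_map_cell_map:
  assumes "n \<le> m" "singular_simplex n V \<sigma>"
  shows "closed_map (subtopology (Euclidean_space n) (unit_disc n)) (skeleton m V) (cell_map n \<sigma>)"
  by (rule continuous_imp_closed_map[OF continuous_map_cell_map[OF assms] compact_space_unit_disc Hausdorff_skeleton])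

lemma simplex_point_boundary:
  assumes x: "x \<in> standard_simplex n" "x \<notin> open_simplex n"
  obtains S where "S \<subseteq> {..n}" "S \<noteq> {}" "card S - 1 < n"
    "simplex_point \<sigma> x \<in> {face_on S \<sigma>} \<times> open_simplex (card S - 1)"
proof (rule that[of "support x"])
  note S = support_simplex[OF x(1)]
  show "support x \<subseteq> {..n}" "support x \<noteq> {}" by (rule S)+
  have "support x \<noteq> {..n}" using support_open_simplex[OF x(1)] x(2) by simp
  then have "card (support x) < card {..n}" using S(1) by (intro psubset_card_mono) auto
  moreover have "card (support x) \<noteq> 0" using S by simp
  ultimately show "card (support x) - 1 < n" by simp
  show "simplex_point \<sigma> x \<in> {face_on (support x) \<sigma>} \<times> open_simplex (card (support x) - 1)"
    using face_coordinates_in_open_simplex[OF x(1)] by (simp add: simplex_point_def)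
qed

lemma open_unit_disc_subset: "open_unit_disc n \<subseteq> unit_disc n"
  by (auto simp: open_unit_disc_def unit_disc_def)

lemma unit_disc_subset: "unit_disc n \<subseteq> topspace (Euclidean_space n)"
  by (auto simp: unit_disc_def)

text \<open>
  The characteristic map is closed as a map from a compact space to a Hausdorff space. The open disc
  is the full preimage of its image, since boundary points go to cells of lower
  dimension, so the restriction is closed too, and it is a bijection.
\<close>

lemma homeomorphic_map_cell_map:
  assumes "n \<le> m" and \<sigma>: "singular_simplex n V \<sigma>"
  shows "homeomorphic_map (subtopology (Euclidean_space n) (open_unit_disc n))
           (subtopology (skeleton m V) (cell_map n \<sigma> ` open_unit_disc n)) (cell_map n \<sigma>)"
proof -
  let ?D = "subtopology (Euclidean_space n) (unit_disc n)" and ?O = "cell_map n \<sigma> ` open_unit_disc n"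
  have sub: "subtopology (Euclidean_space n) (open_unit_disc n) = subtopology ?D (open_unit_disc n)"
    using open_unit_disc_subset by (metis inf.absorb2 subtopology_subtopology)
  have pre: "{x \<in> topspace ?D. cell_map n \<sigma> x \<in> ?O} = open_unit_disc n"
  proof
    show "open_unit_disc n \<subseteq> {x \<in> topspace ?D. cell_map n \<sigma> x \<in> ?O}"
      using open_unit_disc_subset unit_disc_subset by fastforce
    show "{x \<in> topspace ?D. cell_map n \<sigma> x \<in> ?O} \<subseteq> open_unit_disc n"
    proof
      fix x assume "x \<in> {x \<in> topspace ?D. cell_map n \<sigma> x \<in> ?O}"
      then have x: "x \<in> unit_disc n" and O: "cell_map n \<sigma> x \<in> {\<sigma>} \<times> open_simplex n"
        by (auto simp: cell_map_image_open[OF \<sigma>])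
      have t: "disc_to_simplex n x \<in> standard_simplex n"
        using x disc_to_simplex_image_disc by blast
      have "disc_to_simplex n x \<in> open_simplex n"
      proof (rule ccontr)
        assume "disc_to_simplex n x \<notin> open_simplex n"
        from simplex_point_boundary[OF t this] obtain S where S: "card S - 1 < n"
          "simplex_point \<sigma> (disc_to_simplex n x) \<in> {face_on S \<sigma>} \<times> open_simplex (card S - 1)"
          by metis
        then have "snd (cell_map n \<sigma> x) \<in> open_simplex (card S - 1)"
          by (auto simp: cell_map_def)
        moreover have "snd (cell_map n \<sigma> x) \<in> open_simplex n"
          using O by auto
        ultimately show False
          using open_simplex_unique S(1) by (metis less_irrefl)
      qed
      then show "x \<in> open_unit_disc n"
        using disc_to_simplex_in_open_simplex_iff[OF x] by simp
    qed
  qed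
  have top: "topspace (subtopology ?D (open_unit_disc n)) = open_unit_disc n"
    using open_unit_disc_subset unit_disc_subset by fastforce
  have sp: "?O \<subseteq> topspace (skeleton m V)"
    using \<open>n \<le> m\<close> \<sigma> by (auto simp: cell_map_image_open[OF \<sigma>] topspace_skeleton skeleton_points_def)
  show ?thesis
    unfolding sub
  proof (rule bijective_closed_imp_homeomorphic_map)
    show "continuous_map (subtopology ?D (open_unit_disc n)) (subtopology (skeleton m V) ?O) (cell_map n \<sigma>)"
      using continuous_map_cell_map[OF assms] top
      by (simp add: continuous_map_in_subtopology continuous_map_from_subtopology Pi_iff)
    show "closed_map (subtopology ?D (open_unit_disc n)) (subtopology (skeleton m V) ?O) (cell_map n \<sigma>)"
      by (rule closed_map_restriction[OF closed_map_cell_map[OF assms] pre])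
    show "cell_map n \<sigma> ` topspace (subtopology ?D (open_unit_disc n)) = topspace (subtopology (skeleton m V) ?O)"
      using top sp by (simp add: Int_absorb1)
    have "inj_on (disc_to_simplex n) (open_unit_disc n)"
      by (rule inj_on_subset[OF inj_on_disc_to_simplex open_unit_disc_subset])
    moreover have "inj_on (simplex_point \<sigma>) (open_simplex n)"
      by (auto simp: inj_on_def simplex_point_open[OF \<sigma>])
    ultimately show "inj_on (cell_map n \<sigma>) (topspace (subtopology ?D (open_unit_disc n)))"
      unfolding top cell_map_def by (intro comp_inj_on) (simp_all add: disc_to_simplex_image_open_disc)
  qed
qed

text \<open>
  Closed cells are compact, hence closed in the Hausdorff skeleton; conversely a set that
  is closed in each closed cell has closed preimages in all simplices, which is closedness by
  definition of the topology.
\<close>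

lemma CW_structure_skeleton: "CW_structure (skeleton m V) (skeleton_cells m V)"
  unfolding CW_structure_def
proof (intro conjI)
  show "Hausdorff_space (skeleton m V)" by (rule Hausdorff_skeleton)
  show "\<forall>(n, \<Phi>)\<in>skeleton_cells m V.
       continuous_map (subtopology (Euclidean_space n) (unit_disc n)) (skeleton m V) \<Phi> \<and>
       homeomorphic_map (subtopology (Euclidean_space n) (open_unit_disc n))
        (subtopology (skeleton m V) (\<Phi> ` open_unit_disc n)) \<Phi>"
    by (auto simp: skeleton_cells_def continuous_map_cell_map homeomorphic_map_cell_map)
  show "pairwise (\<lambda>(n, \<Phi>) (n', \<Phi>'). disjnt (\<Phi> ` open_unit_disc n) (\<Phi>' ` open_unit_disc n'))
     (skeleton_cells m V)"
  proof (rule pairwiseI)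
    fix c c' assume "c \<in> skeleton_cells m V" "c' \<in> skeleton_cells m V" and ne: "c \<noteq> c'"
    then obtain n \<sigma> n' \<sigma>' where c: "c = (n, cell_map n \<sigma>)" "singular_simplex n V \<sigma>"
        "c' = (n', cell_map n' \<sigma>')" "singular_simplex n' V \<sigma>'"
      by (auto simp: skeleton_cells_def)
    then have "disjnt ({\<sigma>} \<times> open_simplex n) ({\<sigma>'} \<times> open_simplex n')"
      using ne open_simplex_unique by (auto simp: disjnt_def)
    then show "(\<lambda>(n, \<Phi>) (n', \<Phi>'). disjnt (\<Phi> ` open_unit_disc n) (\<Phi>' ` open_unit_disc n')) c c'"
      using c(1,3) by (simp add: cell_map_image_open[OF c(2)] cell_map_image_open[OF c(4)])
  qed
  show "(\<Union>(n, \<Phi>)\<in>skeleton_cells m V. \<Phi> ` open_unit_disc n) = topspace (skeleton m V)"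
  proof -
    have "(\<Union>(n, \<Phi>)\<in>skeleton_cells m V. \<Phi> ` open_unit_disc n) =
          (\<Union>(n, \<sigma>)\<in>{(n, \<sigma>). n \<le> m \<and> singular_simplex n V \<sigma>}. cell_map n \<sigma> ` open_unit_disc n)"
      unfolding skeleton_cells_def by blast
    also have "\<dots> = (\<Union>(n, \<sigma>)\<in>{(n, \<sigma>). n \<le> m \<and> singular_simplex n V \<sigma>}. {\<sigma>} \<times> open_simplex n)"
      by (rule SUP_cong[OF refl]) (simp add: case_prod_unfold cell_map_image_open[where V = V])
    finally show ?thesis
      by (auto simp: topspace_skeleton skeleton_points_def)
  qed
  show "\<forall>(n, \<Phi>)\<in>skeleton_cells m V. \<exists>\<F>\<subseteq>skeleton_cells m V. finite \<F> \<and>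
      (\<forall>(n', \<Phi>')\<in>\<F>. n' < n) \<and>
      \<Phi> ` unit_disc_boundary n \<subseteq> (\<Union>(n', \<Phi>')\<in>\<F>. \<Phi>' ` open_unit_disc n')"
  proof clarify
    fix n \<Phi> assume "(n, \<Phi>) \<in> skeleton_cells m V"
    then obtain \<sigma> where \<sigma>: "\<Phi> = cell_map n \<sigma>" "n \<le> m" "singular_simplex n V \<sigma>"
      by (auto simp: skeleton_cells_def)
    define \<S> where "\<S> = {S. S \<subseteq> {..n} \<and> S \<noteq> {} \<and> card S - 1 < n}"
    let ?F = "(\<lambda>S. (card S - 1, cell_map (card S - 1) (face_on S \<sigma>))) ` \<S>"
    have face: "singular_simplex (card S - 1) V (face_on S \<sigma>)" if "S \<in> \<S>" for S
      using singular_simplex_face_on[OF \<sigma>(3)] that by (simp add: \<S>_def)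
    have "finite \<S>" by (rule finite_subset[of _ "Pow {..n}"]) (auto simp: \<S>_def)
    then have "finite ?F" by simp
    moreover have "?F \<subseteq> skeleton_cells m V"
    proof
      fix c assume "c \<in> ?F"
      then obtain S where S: "S \<in> \<S>" "c = (card S - 1, cell_map (card S - 1) (face_on S \<sigma>))"
        by blast
      moreover have "card S - 1 \<le> m" using S(1) \<sigma>(2) by (simp add: \<S>_def)
      ultimately show "c \<in> skeleton_cells m V"
        using face[OF S(1)] by (auto simp: skeleton_cells_def)
    qed
    moreover have "\<forall>(n', \<Phi>')\<in>?F. n' < n"
      by (auto simp: \<S>_def)
    moreover have "\<Phi> ` unit_disc_boundary n \<subseteq> (\<Union>(n', \<Phi>')\<in>?F. \<Phi>' ` open_unit_disc n')"
    proof
      fix p assume "p \<in> \<Phi> ` unit_disc_boundary n"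
      then obtain x where x: "x \<in> unit_disc_boundary n" "p = simplex_point \<sigma> (disc_to_simplex n x)"
        by (auto simp: \<sigma>(1) cell_map_def)
      then have xD: "x \<in> unit_disc n" and xO: "x \<notin> open_unit_disc n"
        by (auto simp: unit_disc_boundary_def unit_disc_def open_unit_disc_def)
      have "disc_to_simplex n x \<in> standard_simplex n"
        using xD disc_to_simplex_image_disc by blast
      moreover have "disc_to_simplex n x \<notin> open_simplex n"
        using disc_to_simplex_in_open_simplex_iff[OF xD] xO by simp
      ultimately obtain S where "S \<subseteq> {..n}" "S \<noteq> {}" "card S - 1 < n"
          "simplex_point \<sigma> (disc_to_simplex n x) \<in> {face_on S \<sigma>} \<times> open_simplex (card S - 1)"
        by (rule simplex_point_boundary)
      then have S: "S \<in> \<S>" "p \<in> {face_on S \<sigma>} \<times> open_simplex (card S - 1)"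
        using x(2) by (simp_all add: \<S>_def)
      then have "p \<in> cell_map (card S - 1) (face_on S \<sigma>) ` open_unit_disc (card S - 1)"
        using cell_map_image_open[OF face[OF S(1)]] by simp
      then show "p \<in> (\<Union>(n', \<Phi>')\<in>?F. \<Phi>' ` open_unit_disc n')"
        using S(1) by auto
    qed
    ultimately show "\<exists>\<F>\<subseteq>skeleton_cells m V. finite \<F> \<and> (\<forall>(n', \<Phi>')\<in>\<F>. n' < n) \<and>
      \<Phi> ` unit_disc_boundary n \<subseteq> (\<Union>(n', \<Phi>')\<in>\<F>. \<Phi>' ` open_unit_disc n')"
      by (intro exI[of _ ?F] conjI)
  qed
  show "\<forall>A\<subseteq>topspace (skeleton m V). closedin (skeleton m V) A \<longleftrightarrow>
     (\<forall>(n, \<Phi>)\<in>skeleton_cells m V. closedin (skeleton m V) (A \<inter> \<Phi> ` unit_disc n))"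
  proof (intro allI impI iffI)
    fix A assume A: "closedin (skeleton m V) A"
    have "closedin (skeleton m V) (cell_map n \<sigma> ` unit_disc n)" if "n \<le> m" "singular_simplex n V \<sigma>" for n \<sigma>
    proof -
      have "closedin (subtopology (Euclidean_space n) (unit_disc n)) (unit_disc n)"
        using closedin_topspace[of "subtopology (Euclidean_space n) (unit_disc n)"]
        by (simp add: Int_absorb1 unit_disc_subset)
      then show ?thesis using closed_map_cell_map[OF that] by (simp add: closed_map_def)
    qed
    then show "\<forall>(n, \<Phi>)\<in>skeleton_cells m V. closedin (skeleton m V) (A \<inter> \<Phi> ` unit_disc n)"
      using A by (auto simp: skeleton_cells_def intro: closedin_Int)
  next
    fix A assume A: "A \<subseteq> topspace (skeleton m V)"
      and cl: "\<forall>(n, \<Phi>)\<in>skeleton_cells m V. closedin (skeleton m V) (A \<inter> \<Phi> ` unit_disc n)"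
    show "closedin (skeleton m V) A"
      unfolding closedin_skeleton
    proof (intro conjI allI impI)
      show "A \<subseteq> skeleton_points m V" using A by (simp add: topspace_skeleton)
      fix n \<sigma> assume n: "n \<le> m \<and> singular_simplex n V \<sigma>"
      then have "(n, cell_map n \<sigma>) \<in> skeleton_cells m V"
        by (auto simp: skeleton_cells_def)
      with cl have "closedin (skeleton m V) (A \<inter> cell_map n \<sigma> ` unit_disc n)"
        by blast
      then have "closedin (skeleton m V) (A \<inter> simplex_point \<sigma> ` standard_simplex n)"
        by (simp only: cell_map_image_disc)
      with n have "closedin (simplex_space n)
         {x \<in> topspace (simplex_space n). simplex_point \<sigma> x \<in> A \<inter> simplex_point \<sigma> ` standard_simplex n}"
        by (intro closedin_continuous_map_preimage[OF continuous_map_simplex_point]) auto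
      moreover have "{x \<in> topspace (simplex_space n). simplex_point \<sigma> x \<in> A \<inter> simplex_point \<sigma> ` standard_simplex n}
         = {x \<in> standard_simplex n. simplex_point \<sigma> x \<in> A}"
        by auto
      ultimately show "closedin (simplex_space n) {x \<in> standard_simplex n. simplex_point \<sigma> x \<in> A}"
        by simp
    qed
  qed
qed

text \<open>
  A point gives a constant singular simplex of dimension \<open>m\<close>, so the dimension \<open>m\<close> is attained.
\<close>

lemma CW_complex_skeleton:
  assumes "topspace V \<noteq> {}"
  shows "CW_complex_of_dim m (skeleton m V)"
proof -
  obtain a where "a \<in> topspace V" using assms by blast
  then have "singular_simplex m V (restrict (\<lambda>_. a) (standard_simplex m))"
    by (simp add: singular_simplex_def)
  then have "(m, cell_map m (restrict (\<lambda>_. a) (standard_simplex m))) \<in> skeleton_cells m V"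
    by (auto simp: skeleton_cells_def)
  moreover have "\<forall>(n, \<Phi>)\<in>skeleton_cells m V. n \<le> m"
    by (auto simp: skeleton_cells_def)
  ultimately show ?thesis
    unfolding CW_complex_of_dim_def using CW_structure_skeleton by (intro exI[of _ "skeleton_cells m V"]) blast
qed

text \<open>
  The canonical map from the realisation to the space: it restricts to \<open>\<sigma>\<close> on the cell of \<open>\<sigma>\<close>.
\<close>

lemma continuous_map_skeleton_eval: "continuous_map (skeleton m V) V (\<lambda>(\<sigma>, x). \<sigma> x)"
proof (rule continuous_map_from_skeleton)
  fix n \<sigma> assume "n \<le> m" "singular_simplex n V \<sigma>"
  then have "continuous_map (simplex_space n) V \<sigma>" by (simp add: singular_simplex_def)
  then show "continuous_map (simplex_space n) V (\<lambda>x. case simplex_point \<sigma> x of (\<sigma>, x) \<Rightarrow> \<sigma> x)"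
    by (rule continuous_map_eq) (simp add: case_prod_unfold simplex_point_eval[of _ n])
qed

section \<open>Classes vanishing on the diagonal\<close>

lemma pullback_compose:
  assumes "continuous_map X Y f"
  shows "cochain_pullback n X f (cochain_pullback n Y h c) = cochain_pullback n X (h \<circ> f) c"
  using singular_simplex_simplex_map[OF _ assms, of n]
  by (auto simp: cochain_pullback_def simplex_map_compose)

text \<open>
  The homotopy \<open>K\<close> from \<open>f\<close> to \<open>g\<close> on the \<open>m\<close>-skeleton of the realisation of \<open>U\<close> provides, for each
  singular simplex \<open>\<sigma>\<close> of \<open>U\<close> of dimension at most \<open>m\<close>, a homotopy \<open>H \<sigma>\<close> in \<open>Y \<times> Y\<close> from \<open>(f,f)\<circ>\<sigma>\<close> to
  \<open>(f,g)\<circ>\<sigma>\<close>, and these homotopies are compatible with faces. Their images of the prism chains form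
  a chain homotopy between \<open>(f,f)\<close> and \<open>(f,g)\<close> on the chains of \<open>U\<close> up to dimension \<open>m\<close>. The cocycle
  \<open>c\<close> composed with it is a cochain \<open>e\<close> with \<open>(f,g)\<^sup>* c = (f,f)\<^sup>* c + \<delta>e\<close> on \<open>U\<close>, and \<open>(f,f)\<^sup>* c\<close> is a
  coboundary since \<open>(f,f)\<close> factors through the diagonal.
\<close>

lemma m_homotopic_pullback_coboundary:
  fixes X :: "'a topology" and c :: "('b \<times> 'b, 'r::comm_ring_1) cochain"
  assumes f: "continuous_map X Y f" and g: "continuous_map X Y g"
    and hom: "m_homotopic_on m X Y U f g" and n: "n \<le> m"
    and c: "c \<in> cocycles n (prod_topology Y Y)"
    and diag: "cochain_pullback n Y (\<lambda>y. (y, y)) c \<in> coboundaries n Y"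
  shows "\<exists>s\<in>coboundaries n X. \<forall>\<sigma>. singular_simplex n (subtopology X U) \<sigma> \<longrightarrow>
           cochain_pullback n X (\<lambda>x. (f x, g x)) c \<sigma> = s \<sigma>"
proof (cases "topspace (subtopology X U) = {}")
  case True
  then show ?thesis
    by (intro bexI[of _ "\<lambda>\<sigma>. 0"]) (auto simp: singular_simplex_empty)
next
  case False
  define V where "V = subtopology X U"
  define \<phi> :: "'a realisation_point \<Rightarrow> 'a" where "\<phi> = (\<lambda>(\<sigma>, x). \<sigma> x)"
  have "homotopic_with (\<lambda>h. True) (skeleton m V) Y (f \<circ> \<phi>) (g \<circ> \<phi>)"
    using hom CW_complex_skeleton[of V m] continuous_map_skeleton_eval[of m V] False
    unfolding m_homotopic_on_def V_def \<phi>_def by blast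
  then obtain K where K: "continuous_map (prod_topology (top_of_set {0..1::real}) (skeleton m V)) Y K"
    and K0: "\<And>p. K (0, p) = f (\<phi> p)" and K1: "\<And>p. K (1, p) = g (\<phi> p)"
    unfolding homotopic_with_def o_def by (elim exE conjE) blast
  obtain Q where Q: "\<And>n. singular_chain (Suc n) (simplex_cylinder n) (Q n)"
    and bQ: "\<And>n. chain_boundary (Suc n) (Q n) =
       chain_map n (Pair 1) (frag_of (simplex_id n)) - chain_map n (Pair 0) (frag_of (simplex_id n))
       - (if n = 0 then 0 else
          \<Sum>k\<le>n. frag_cmul ((-1) ^ k) (chain_map n (map_prod id (simplical_face k)) (Q (n - 1))))"
    by (rule prism_chains) blast
  define H where "H \<sigma> = (\<lambda>(t, x). (f (\<sigma> x), K (t, simplex_point \<sigma> x)))" for \<sigma>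
  have H: "continuous_map (simplex_cylinder j) (prod_topology Y Y) (H \<sigma>)"
    if "j \<le> m" "singular_simplex j V \<sigma>" for j \<sigma>
  proof -
    have "continuous_map V Y f" using f by (simp add: V_def continuous_map_from_subtopology)
    then have "continuous_map (simplex_space j) Y (f \<circ> \<sigma>)"
      using that(2) by (intro continuous_map_compose) (auto simp: singular_simplex_def)
    from continuous_map_compose[OF continuous_map_snd[of "top_of_set {0..1::real}"] this]
    have 1: "continuous_map (simplex_cylinder j) Y (\<lambda>z. f (\<sigma> (snd z)))"
      by (simp add: o_def)
    have "continuous_map (simplex_cylinder j) (prod_topology (top_of_set {0..1::real}) (skeleton m V))
        (\<lambda>z. (fst z, simplex_point \<sigma> (snd z)))"
      using continuous_map_compose[OF continuous_map_snd[of "top_of_set {0..1::real}"]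
          continuous_map_simplex_point[OF that]]
        continuous_map_fst[of "top_of_set {0..1::real}" "simplex_space j"]
      unfolding continuous_map_pairwise by (simp add: o_def)
    from continuous_map_compose[OF this K]
    have 2: "continuous_map (simplex_cylinder j) Y (\<lambda>z. K (fst z, simplex_point \<sigma> (snd z)))"
      by (simp add: o_def)
    show ?thesis
      unfolding H_def case_prod_unfold continuous_map_pairwise using 1 2 by (simp add: o_def)
  qed
  \<comment> \<open>Defined for all simplices, but a homotopy between continuous maps only for simplices of the open
      set and \<open>j \<le> m\<close>; the cochain \<open>e'\<close> below is set to zero elsewhere.\<close>
  define e where "e j \<sigma> = cochain_eval c (chain_map (Suc j) (H \<sigma>) (Q j))" for j \<sigma>
  let ?fg = "\<lambda>x. (f x, g x)" and ?ff = "\<lambda>x. (f x, f x)"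
  have bdry: "c (simplex_map n ?fg \<sigma>) = c (simplex_map n ?ff \<sigma>)
      + (if n = 0 then 0 else \<Sum>k\<le>n. (-1) ^ k * e (n - 1) (singular_face n k \<sigma>))"
    if \<sigma>: "singular_simplex n V \<sigma>" for \<sigma>
  proof -
    have ends: "chain_map n (H \<sigma>) (chain_map n (Pair 1) (frag_of (simplex_id n))) = frag_of (simplex_map n ?fg \<sigma>)"
      "chain_map n (H \<sigma>) (chain_map n (Pair 0) (frag_of (simplex_id n))) = frag_of (simplex_map n ?ff \<sigma>)"
      using simplex_point_eval[of _ n \<sigma>]
      by (auto simp: simplex_map_def H_def K0 K1 \<phi>_def case_prod_unfold intro!: arg_cong[of _ _ frag_of] restrict_ext)
    have side: "chain_map n (H \<sigma>) (chain_map n (map_prod id (simplical_face k)) (Q (n - 1))) =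
        chain_map n (H (singular_face n k \<sigma>)) (Q (n - 1))" if nk: "n \<noteq> 0" "k \<le> n" for k
    proof -
      obtain p where p: "n = Suc p" using nk(1) not0_implies_Suc by blast
      have "chain_map n (H \<sigma>) (chain_map n (map_prod id (simplical_face k)) (Q p)) =
            chain_map n (H \<sigma> \<circ> map_prod id (simplical_face k)) (Q p)"
        by (simp add: chain_map_compose)
      also have "\<dots> = chain_map n (H (singular_face n k \<sigma>)) (Q p)"
        unfolding p
      proof (rule chain_map_eq[OF Q])
        fix z assume "z \<in> topspace (simplex_cylinder p)"
        then have "snd z \<in> standard_simplex p" by auto
        then show "(H \<sigma> \<circ> map_prod id (simplical_face k)) z = H (singular_face (Suc p) k \<sigma>) z"
          using simplex_point_face[of "snd z" p k \<sigma>] nk(2) p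
          by (simp add: H_def case_prod_unfold singular_face_def)
      qed
      finally show ?thesis by (simp add: p)
    qed
    have "cochain_eval c (chain_boundary (Suc n) (chain_map (Suc n) (H \<sigma>) (Q n))) = 0"
      by (rule cocycle_eval_boundary[OF c singular_chain_chain_map[OF Q H[OF n \<sigma>]]])
    moreover have "chain_boundary (Suc n) (chain_map (Suc n) (H \<sigma>) (Q n)) =
        frag_of (simplex_map n ?fg \<sigma>) - frag_of (simplex_map n ?ff \<sigma>)
        - (if n = 0 then 0 else
          \<Sum>k\<le>n. frag_cmul ((-1) ^ k) (chain_map n (H (singular_face n k \<sigma>)) (Q (n - 1))))"
      unfolding chain_boundary_chain_map[OF Q] diff_Suc_Suc diff_zero bQ chain_map_diff ends
      using side by (simp add: chain_map_sum)
    ultimately show ?thesis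
      by (simp add: cochain_eval_diff cochain_eval_sum cochain_eval_sign e_def diff_eq_eq add.commute split: if_splits)
  qed
  define s0 where "s0 = cochain_pullback n X f (cochain_pullback n Y (\<lambda>y. (y, y)) c)"
  have s0: "s0 \<in> coboundaries n X"
    unfolding s0_def by (rule pullback_coboundaries[OF f diag])
  have s0_eq: "s0 = cochain_pullback n X ?ff c"
    unfolding s0_def by (simp add: pullback_compose[OF f] o_def)
  have simplex_X: "singular_simplex n X \<sigma>" if "singular_simplex n V \<sigma>" for n \<sigma>
    using that by (simp add: V_def singular_simplex_subtopology)
  show ?thesis
  proof (cases n)
    case 0
    have "cochain_pullback n X ?fg c \<sigma> = s0 \<sigma>" if "singular_simplex n V \<sigma>" for \<sigma>
      using bdry[OF that] 0 simplex_X[OF that] by (simp add: s0_eq cochain_pullback_def)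
    then show ?thesis using s0 by (auto simp: V_def)
  next
    case (Suc p)
    define e' where "e' \<tau> = (if singular_simplex p V \<tau> then e p \<tau> else 0)" for \<tau>
    have "e' \<in> cochains p X"
      using simplex_X by (auto simp: cochains_def e'_def)
    then have "cochain_coboundary p X e' \<in> coboundaries n X"
      by (auto simp: Suc coboundaries_Suc_iff)
    from coboundaries_add[OF s0 this]
    have "(\<lambda>\<sigma>. s0 \<sigma> + cochain_coboundary p X e' \<sigma>) \<in> coboundaries n X" .
    moreover have "cochain_pullback n X ?fg c \<sigma> = s0 \<sigma> + cochain_coboundary p X e' \<sigma>"
      if \<sigma>: "singular_simplex n V \<sigma>" for \<sigma>
    proof -
      have "singular_simplex p V (singular_face (Suc p) k \<sigma>)" if "k \<le> Suc p" for k
        using singular_simplex_singular_face[of "Suc p" V \<sigma> k] \<sigma> that by (simp add: Suc)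
      then have "cochain_coboundary p X e' \<sigma> = (\<Sum>k\<le>Suc p. (-1) ^ k * e p (singular_face (Suc p) k \<sigma>))"
        using simplex_X[OF \<sigma>] by (simp add: Suc coboundary_simplex e'_def del: sum.atMost_Suc)
      then show ?thesis
        using bdry[OF \<sigma>] simplex_X[OF \<sigma>] by (simp add: Suc s0_eq cochain_pullback_def del: sum.atMost_Suc)
    qed
    ultimately show ?thesis
      by (intro bexI[of _ "\<lambda>\<sigma>. s0 \<sigma> + cochain_coboundary p X e' \<sigma>"]) (simp_all add: V_def)
  qed
qed

section \<open>The cup-length bound\<close>

lemma coset_coboundaries:
  "coboundaries n X #>\<^bsub>cocycle_group n X\<^esub> c = (\<lambda>b \<sigma>. b \<sigma> + c \<sigma>) ` coboundaries n X"
  by (auto simp: r_coset_def cocycle_group_def)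

lemma mem_coset_self: "c \<in> coboundaries n X #>\<^bsub>cocycle_group n X\<^esub> c"
  unfolding coset_coboundaries by (rule image_eqI[of _ _ "\<lambda>\<sigma>. 0"]) auto

lemma coset_of_coboundary:
  fixes c :: "('a, 'r::comm_ring_1) cochain"
  assumes "c \<in> coboundaries n X"
  shows "coboundaries n X #>\<^bsub>cocycle_group n X\<^esub> c = coboundaries n X"
proof
  show "coboundaries n X #>\<^bsub>cocycle_group n X\<^esub> c \<subseteq> coboundaries n X"
    unfolding coset_coboundaries using coboundaries_add assms by fastforce
  show "coboundaries n X \<subseteq> coboundaries n X #>\<^bsub>cocycle_group n X\<^esub> c"
  proof
    fix b :: "('a, 'r) cochain" assume "b \<in> coboundaries n X"
    then have "(\<lambda>\<sigma>. b \<sigma> + - c \<sigma>) \<in> coboundaries n X"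
      by (rule coboundaries_add[OF _ coboundaries_minus[OF assms]])
    then show "b \<in> coboundaries n X #>\<^bsub>cocycle_group n X\<^esub> c"
      unfolding coset_coboundaries by (rule image_eqI[rotated]) auto
  qed
qed

lemma one_cohomology_group: "\<one>\<^bsub>cohomology_group n X\<^esub> = coboundaries n X"
  by (simp add: cohomology_group_def FactGroup_def)

lemma cohomology_class_cocycles:
  assumes "v \<in> carrier (cohomology_group n X)" "c \<in> v"
  shows "c \<in> cocycles n X"
proof -
  obtain a where "a \<in> cocycles n X" "v = coboundaries n X #>\<^bsub>cocycle_group n X\<^esub> a"
    using assms(1) by (auto simp: cohomology_group_def FactGroup_def RCOSETS_def cocycle_group_def)
  then show ?thesis
    using assms(2) coboundaries_subset_cocycles[of n X] unfolding coset_coboundaries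
    by (auto intro: cocycles_add)
qed

lemma cohomology_class_nonempty:
  assumes "v \<in> carrier (cohomology_group n X)"
  shows "v \<noteq> {}"
  using assms mem_coset_self[of _ n X]
  by (auto simp: cohomology_group_def FactGroup_def RCOSETS_def)

lemma iterated_cup_nonempty:
  assumes "\<And>i. i \<le> k \<Longrightarrow> u i \<noteq> {}"
  shows "iterated_cup Z d u k \<noteq> {}"
  using assms
proof (induction k)
  case (Suc k)
  then obtain a b where "a \<in> iterated_cup Z d u k" "b \<in> u (Suc k)"
    by (meson all_not_in_conv le_SucI order_refl)
  then show ?case
    using mem_coset_self by (fastforce simp: cup_product_def)
qed simp

lemma cup_vanishing:
  assumes "a \<in> cochains p X" "singular_simplex (p + q) (subtopology X W) \<sigma>"
    and "(\<forall>\<tau>. singular_simplex p (subtopology X W) \<tau> \<longrightarrow> a \<tau> = 0) \<or>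
         (\<forall>\<tau>. singular_simplex q (subtopology X W) \<tau> \<longrightarrow> b \<tau> = 0)"
  shows "cochain_cup p q X a b \<sigma> = 0"
  using assms(3) singular_simplex_front_face[OF assms(2)] singular_simplex_back_face[OF assms(2)]
  by (auto simp: cochain_cup_def)

text \<open>
  Classes with representatives vanishing on the simplices of the sets \<open>W i\<close> have an iterated cup
  product with a representative vanishing on the simplices of every \<open>W i\<close>: a cup product of
  cochains vanishes on a simplex as soon as one factor does on all simplices of a set
  containing it. The remaining terms of the product contain a coboundary and a cocycle as
  factors, so they are coboundaries by the Leibniz rule.
\<close>

lemma iterated_cup_pullback:
  fixes u :: "nat \<Rightarrow> ('c, 'r::comm_ring_1) cochain set"
  assumes F: "continuous_map X Z F"
    and rep: "\<And>i c. \<lbrakk>i \<le> k; c \<in> u i\<rbrakk> \<Longrightarrow> \<exists>z\<in>cocycles (d i) X.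
        (\<forall>\<sigma>. singular_simplex (d i) (subtopology X (W i)) \<sigma> \<longrightarrow> z \<sigma> = 0) \<and>
        (\<exists>s\<in>coboundaries (d i) X. cochain_pullback (d i) X F c = (\<lambda>\<sigma>. z \<sigma> + s \<sigma>))"
    and e: "e \<in> iterated_cup Z d u k"
  shows "\<exists>z\<in>cocycles (\<Sum>i\<le>k. d i) X.
        (\<forall>i\<le>k. \<forall>\<sigma>. singular_simplex (\<Sum>i\<le>k. d i) (subtopology X (W i)) \<sigma> \<longrightarrow> z \<sigma> = 0) \<and>
        (\<exists>s\<in>coboundaries (\<Sum>i\<le>k. d i) X. cochain_pullback (\<Sum>i\<le>k. d i) X F e = (\<lambda>\<sigma>. z \<sigma> + s \<sigma>))"
  using rep e
proof (induction k arbitrary: e)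
  case 0
  from 0(1)[of 0 e] 0(2) show ?case by simp
next
  case (Suc k)
  let ?p = "\<Sum>i\<le>k. d i" and ?q = "d (Suc k)"
  from Suc.prems(2) obtain a b \<beta> where a: "a \<in> iterated_cup Z d u k" and b: "b \<in> u (Suc k)"
    and \<beta>: "\<beta> \<in> coboundaries (?p + ?q) Z" and e: "e = (\<lambda>\<sigma>. \<beta> \<sigma> + cochain_cup ?p ?q Z a b \<sigma>)"
    by (auto simp: cup_product_def coset_coboundaries)
  obtain z s where z: "z \<in> cocycles ?p X"
    "\<And>i \<sigma>. \<lbrakk>i \<le> k; singular_simplex ?p (subtopology X (W i)) \<sigma>\<rbrakk> \<Longrightarrow> z \<sigma> = 0"
    and s: "s \<in> coboundaries ?p X" and za: "cochain_pullback ?p X F a = (\<lambda>\<sigma>. z \<sigma> + s \<sigma>)"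
    using Suc.IH[OF Suc.prems(1) a] by auto
  obtain z' s' where z': "z' \<in> cocycles ?q X"
    "\<And>\<sigma>. singular_simplex ?q (subtopology X (W (Suc k))) \<sigma> \<Longrightarrow> z' \<sigma> = 0"
    and s': "s' \<in> coboundaries ?q X" and zb: "cochain_pullback ?q X F b = (\<lambda>\<sigma>. z' \<sigma> + s' \<sigma>)"
    using Suc.prems(1)[OF _ b] by auto
  have b': "cochain_pullback ?q X F b \<in> cocycles ?q X"
    unfolding zb using z'(1) s' coboundaries_subset_cocycles by (blast intro: cocycles_add)
  let ?cup = "cochain_cup ?p ?q X"
  define r where "r = (\<lambda>\<sigma>. cochain_pullback (?p + ?q) X F \<beta> \<sigma> +
      (?cup s (cochain_pullback ?q X F b) \<sigma> + ?cup z s' \<sigma>))"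
  have "r \<in> coboundaries (?p + ?q) X"
    unfolding r_def
    by (intro coboundaries_add pullback_coboundaries[OF F \<beta>] cup_coboundary_left[OF s b']
        cup_coboundary_right[OF z(1) s'])
  moreover have "cochain_pullback (?p + ?q) X F e = (\<lambda>\<sigma>. ?cup z z' \<sigma> + r \<sigma>)"
  proof -
    have "cochain_pullback (?p + ?q) X F e = (\<lambda>\<sigma>. cochain_pullback (?p + ?q) X F \<beta> \<sigma> +
        ?cup (cochain_pullback ?p X F a) (cochain_pullback ?q X F b) \<sigma>)"
      by (simp only: e pullback_add pullback_cup[OF F])
    also have "?cup (cochain_pullback ?p X F a) (cochain_pullback ?q X F b) =
        (\<lambda>\<sigma>. ?cup z (cochain_pullback ?q X F b) \<sigma> + ?cup s (cochain_pullback ?q X F b) \<sigma>)"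
      by (simp only: za cup_add_left)
    also have "?cup z (cochain_pullback ?q X F b) = (\<lambda>\<sigma>. ?cup z z' \<sigma> + ?cup z s' \<sigma>)"
      by (simp only: zb cup_add_right)
    finally show ?thesis by (simp add: r_def algebra_simps)
  qed
  moreover have "?cup z z' \<in> cocycles (?p + ?q) X"
    by (rule cup_cocycles[OF z(1) z'(1)])
  moreover have "?cup z z' \<sigma> = 0"
    if "i \<le> Suc k" "singular_simplex (?p + ?q) (subtopology X (W i)) \<sigma>" for i \<sigma>
    using that z'(2) z(2)[of i] z(1) by (intro cup_vanishing[OF _ that(2)]) (auto simp: cocycles_def le_Suc_eq)
  ultimately show ?case by auto
qed

theorem proposition4p17:
  fixes X :: "'a topology" and Y :: "'b topology"
    and f g :: "'a \<Rightarrow> 'b"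
    and u :: "nat \<Rightarrow> ('b \<times> 'b, 'r::comm_ring_1) cochain set"
    and d :: "nat \<Rightarrow> nat" and k m :: nat
  assumes "continuous_map X Y f" and "continuous_map X Y g"
    and "\<And>i. i \<le> k \<Longrightarrow> u i \<in> carrier (cohomology_group (d i) (prod_topology Y Y))"
    and "\<And>i. i \<le> k \<Longrightarrow>
           cohomology_induced (d i) Y (\<lambda>y. (y, y)) (u i) = \<one>\<^bsub>cohomology_group (d i) Y\<^esub>"
    and "cohomology_induced (\<Sum>i\<le>k. d i) X (\<lambda>x. (f x, g x)) (iterated_cup (prod_topology Y Y) d u k)
           \<noteq> \<one>\<^bsub>cohomology_group (\<Sum>i\<le>k. d i) X\<^esub>"
    and "m = Max {d i | i. i \<le> k}"
  shows "homotopic_distance m X Y f g \<ge> enat (k + 1)"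
  unfolding homotopic_distance_def
proof (rule Inf_greatest)
  let ?Z = "prod_topology Y Y" and ?F = "\<lambda>x. (f x, g x)" and ?N = "\<Sum>i\<le>k. d i"
  fix l assume "l \<in> {enat j | j. \<exists>U :: nat \<Rightarrow> 'a set. (\<forall>i\<le>j. openin X (U i)) \<and> (\<Union>i\<le>j. U i) = topspace X \<and>
           (\<forall>i\<le>j. m_homotopic_on m X Y (U i) f g)}"
  then obtain j and U :: "nat \<Rightarrow> 'a set" where l: "l = enat j" and op: "\<And>i. i \<le> j \<Longrightarrow> openin X (U i)"
    and cov: "(\<Union>i\<le>j. U i) = topspace X" and hom: "\<And>i. i \<le> j \<Longrightarrow> m_homotopic_on m X Y (U i) f g"
    by blast
  have F: "continuous_map X ?Z ?F"
    using assms(1,2) by (simp add: continuous_map_pairwise o_def)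
  have "k < j"
  proof (rule ccontr)
    assume "\<not> k < j"
    \<comment> \<open>The cover may have fewer than \<open>k + 1\<close> members; the last one is then repeated.\<close>
    define W where "W i = U (min i j)" for i
    have rep: "\<exists>z\<in>cocycles (d i) X.
        (\<forall>\<sigma>. singular_simplex (d i) (subtopology X (W i)) \<sigma> \<longrightarrow> z \<sigma> = 0) \<and>
        (\<exists>s\<in>coboundaries (d i) X. cochain_pullback (d i) X ?F c = (\<lambda>\<sigma>. z \<sigma> + s \<sigma>))"
      if i: "i \<le> k" and c: "c \<in> u i" for i c
    proof -
      have "d i \<le> m"
        unfolding assms(6) using i by (intro Max_ge) auto
      moreover have cc: "c \<in> cocycles (d i) ?Z"
        by (rule cohomology_class_cocycles[OF assms(3)[OF i] c])
      moreover have "cochain_pullback (d i) Y (\<lambda>y. (y, y)) c \<in> coboundaries (d i) Y"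
        using assms(4)[OF i] c mem_coset_self
        unfolding one_cohomology_group cohomology_induced_def by blast
      moreover have "m_homotopic_on m X Y (W i) f g"
        by (simp add: W_def hom)
      ultimately obtain s where s: "s \<in> coboundaries (d i) X"
        "\<And>\<sigma>. singular_simplex (d i) (subtopology X (W i)) \<sigma> \<Longrightarrow> cochain_pullback (d i) X ?F c \<sigma> = s \<sigma>"
        using m_homotopic_pullback_coboundary[OF assms(1,2)] by blast
      have "(\<lambda>\<sigma>. cochain_pullback (d i) X ?F c \<sigma> - s \<sigma>) \<in> cocycles (d i) X"
        using s(1) coboundaries_subset_cocycles by (intro cocycles_diff pullback_cocycles[OF F cc]) blast
      with s show ?thesis
        by (intro bexI[of _ "\<lambda>\<sigma>. cochain_pullback (d i) X ?F c \<sigma> - s \<sigma>"] conjI bexI[of _ s]) auto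
    qed
    have pull: "cochain_pullback ?N X ?F e \<in> coboundaries ?N X" if e: "e \<in> iterated_cup ?Z d u k" for e
    proof -
      obtain z s where z: "z \<in> cocycles ?N X"
        "\<And>i \<sigma>. \<lbrakk>i \<le> k; singular_simplex ?N (subtopology X (W i)) \<sigma>\<rbrakk> \<Longrightarrow> z \<sigma> = 0"
        and s: "s \<in> coboundaries ?N X" "cochain_pullback ?N X ?F e = (\<lambda>\<sigma>. z \<sigma> + s \<sigma>)"
        using iterated_cup_pullback[OF F rep e] by blast
      have "z \<in> coboundaries ?N X"
      proof (rule cocycle_vanishing_on_small_simplices[OF z(1), where \<C> = "W ` {..k}"])
        have "(\<Union>i\<le>j. U i) \<subseteq> \<Union>(W ` {..k})"
        proof
          fix x assume "x \<in> (\<Union>i\<le>j. U i)"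
          then obtain i where "i \<le> j" "x \<in> U i" by blast
          then have "i \<le> k" "x \<in> W i" using \<open>\<not> k < j\<close> by (simp_all add: W_def)
          then show "x \<in> \<Union>(W ` {..k})" by blast
        qed
        then show "topspace X \<subseteq> \<Union>(W ` {..k})" using cov by simp
      qed (use z(2) op in \<open>auto simp: W_def\<close>)
      then show ?thesis unfolding s(2) using s(1) by (rule coboundaries_add)
    qed
    have "iterated_cup ?Z d u k \<noteq> {}"
      by (rule iterated_cup_nonempty) (use cohomology_class_nonempty assms(3) in blast)
    then have "cohomology_induced ?N X ?F (iterated_cup ?Z d u k) = coboundaries ?N X"
      using coset_of_coboundary[OF pull] by (simp add: cohomology_induced_def)
    then show False using assms(5) by (simp add: one_cohomology_group)
  qed
  then show "enat (k + 1) \<le> l" by (simp add: l)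
qed

end
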